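(* Let $N\ge1$, $\beta>0$, $c_f>c_a>0$, $p_n>0$ with $\sum_{n=1}^N p_n=1$, $\lambda_n>0$ for $n=1,\dots,N$, and put $y_n^*=\frac{\beta p_n}{\lambda_n}$. Assume the items are ordered so that $y_1^*\ge y_2^*\ge\dots\ge y_N^*$. Let $f^*\in(1,2)$ be the zero-gain threshold, let $n^*=\max\{n : y_n^*>f^*\}$ (with $n^*=0$ if there is no such $n$), and let $\mathcal G_1=\{1,\dots,n^*\}$, $\mathcal G_2=\{1,\dots,N\}\setminus\mathcal G_1$. Assume $\sqrt{2\lambda_nc_f/(\beta p_nc_a)}$ is an integer for every $n\in\mathcal G_1$. Apply the optimal push-based policy to every item in $\mathcal G_1$ and the optimal pull-based policy to every item in $\mathcal G_2$. Then the resulting caching scheme has long-run average cost $$C^*=\sum_{n=1}^{n^*}\left(\sqrt{2\lambda_n\beta p_nc_ac_f}-\tfrac12\beta p_nc_a\right)+\sum_{n=n^*+1}^{N}\lambda_nc_a\left(\sqrt{1+\frac{2\beta p_nc_f}{\lambda_nc_a}}-1\right).$$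
   Context: Model: $N$ data items are stored at a back-end database and copies are kept in a local cache with room for all items. Time is continuous. Item $n$ is updated at the database at the jump times of a Poisson process of rate $\lambda_n$, and requests for item $n$ reach the cache at the jump times of a Poisson process of rate $\beta p_n$; all these processes are independent. The age $\Delta_n(t)$ is the number of updates of item $n$ since its cached copy was last fetched; a fetch resets it to $0$. Initially $\Delta_n(0)=0$ and the time since last fetch is $0$. Each fetch costs $c_f$. A request for item $n$ arriving at time $t$ with no fetch of item $n$ at that time costs $c_a\Delta_n(t)$; a request at whose arrival time the item is fetched incurs no aging cost. The long-run average cost is $\lim_{T\to\infty}\frac1T\mathbb E[\text{total cost incurred in }[0,T]]$. Zero-gain threshold: with $G=4c_f/c_a$, $f^*$ is the number in $(1,2)$ such that $F=f^*/2$ satisfies $\frac{\sqrt{1+GF}-1}{\sqrt{GF}-F}=1$. Optimal push-based policy for item $n$ (when $\eta_n^*:=\sqrt{2\lambda_nc_f/(\beta p_nc_a)}$ is an integer): fetch item $n$ as soon as $\Delta_n$ reaches $\eta_n^*$. Optimal pull-based policy for item $n$: fetch item $n$ exactly when a request for it arrives and the time since its last fetch exceeds $\tau_n^*=\frac1{\beta p_n}\Big(\sqrt{1+\frac{2\beta p_nc_f}{c_a\lambda_n}}-1\Big)$. *)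

theory Defs
  imports "HOL-Probability.Probability"
begin

text \<open>
  A Poisson process is given by its sequence of jump times \<open>J 0, J 1, \<dots>\<close>: the waiting
  time until the first jump and the times between consecutive jumps are i.i.d. exponential.
\<close>

definition jump_gap :: "(nat \<Rightarrow> 'w \<Rightarrow> real) \<Rightarrow> nat \<Rightarrow> 'w \<Rightarrow> real" where
  "jump_gap J k \<omega> = (case k of 0 \<Rightarrow> J 0 \<omega> | Suc j \<Rightarrow> J (Suc j) \<omega> - J j \<omega>)"

definition poisson_process :: "'w measure \<Rightarrow> real \<Rightarrow> (nat \<Rightarrow> 'w \<Rightarrow> real) \<Rightarrow> bool" where
  "poisson_process M r J \<longleftrightarrow>
     prob_space.indep_vars M (\<lambda>_. borel) (jump_gap J) UNIV \<and>
     (\<forall>k. distributed M lborel (jump_gap J k) (exponential_density r))"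

text \<open>
  Independence of a family of processes, each regarded as one random element of the sequence
  space. The indices are \<open>Inl n\<close> for the updates and \<open>Inr n\<close> for the requests of item \<open>n\<close>.
\<close>

definition independent_processes ::
    "'w measure \<Rightarrow> 'i set \<Rightarrow> ('i \<Rightarrow> nat \<Rightarrow> 'w \<Rightarrow> real) \<Rightarrow> bool" where
  "independent_processes M I J \<longleftrightarrow>
     prob_space.indep_vars M (\<lambda>_. \<Pi>\<^sub>M k\<in>UNIV. borel) (\<lambda>i \<omega> k. J i k \<omega>) I"

text \<open>
  The remaining definitions concern one realization of a single item: \<open>U\<close> and \<open>R\<close> are
  its update and request times, and \<open>S\<close> is the set of times at which it is fetched.
  The age counts the updates that no fetch has followed; an update at the very time of a fetch
  is included in that fetch.
\<close>

definition age :: "(nat \<Rightarrow> real) \<Rightarrow> real set \<Rightarrow> real \<Rightarrow> nat" where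
  "age U S t = card {j. U j \<le> t \<and> S \<inter> {U j..t} = {}}"

definition item_cost ::
    "real \<Rightarrow> real \<Rightarrow> (nat \<Rightarrow> real) \<Rightarrow> (nat \<Rightarrow> real) \<Rightarrow> real set \<Rightarrow> real \<Rightarrow> real" where
  "item_cost c\<^sub>f c\<^sub>a U R S T =
     c\<^sub>f * real (card (S \<inter> {0..T})) +
     (\<Sum>k | R k \<in> {0..T} \<and> R k \<notin> S. c\<^sub>a * real (age U S (R k)))"

text \<open>
  A policy is given by a predicate \<open>due s t\<close>: if the last fetch was at time \<open>s\<close>, then the policy
  prescribes a fetch at time \<open>t\<close>. The next fetch happens at the first such time after \<open>s\<close>.
  \<open>fetch_time due 0 = 0\<close> encodes the initial state and is not itself a fetch.
\<close>

primrec fetch_time :: "(real \<Rightarrow> real \<Rightarrow> bool) \<Rightarrow> nat \<Rightarrow> real" where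
  "fetch_time due 0 = 0"
| "fetch_time due (Suc k) = Inf {t. fetch_time due k < t \<and> due (fetch_time due k) t}"

definition fetches :: "(real \<Rightarrow> real \<Rightarrow> bool) \<Rightarrow> real set" where
  "fetches due = range (\<lambda>k. fetch_time due (Suc k))"

text \<open>Without a fetch in the meantime, the age is the number of updates since the last fetch.\<close>

definition push_fetches :: "real \<Rightarrow> (nat \<Rightarrow> real) \<Rightarrow> real set" where
  "push_fetches \<eta> U = fetches (\<lambda>s t. real (card {j. U j \<in> {s<..t}}) \<ge> \<eta>)"

definition pull_fetches :: "real \<Rightarrow> (nat \<Rightarrow> real) \<Rightarrow> real set" where
  "pull_fetches \<tau> R = fetches (\<lambda>s t. t \<in> range R \<and> t - s > \<tau>)"

text \<open>Below, \<open>l\<close> and \<open>r\<close> are the update and the request rate of the item.\<close>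

definition optimal_push_threshold :: "real \<Rightarrow> real \<Rightarrow> real \<Rightarrow> real \<Rightarrow> real" where
  "optimal_push_threshold c\<^sub>f c\<^sub>a l r = sqrt (2 * l * c\<^sub>f / (r * c\<^sub>a))"

definition optimal_pull_timeout :: "real \<Rightarrow> real \<Rightarrow> real \<Rightarrow> real \<Rightarrow> real" where
  "optimal_pull_timeout c\<^sub>f c\<^sub>a l r = 1 / r * (sqrt (1 + 2 * r * c\<^sub>f / (c\<^sub>a * l)) - 1)"

definition is_zero_gain_threshold :: "real \<Rightarrow> real \<Rightarrow> real \<Rightarrow> bool" where
  "is_zero_gain_threshold c\<^sub>f c\<^sub>a f \<longleftrightarrow> 1 < f \<and> f < 2 \<and>
     (let G = 4 * c\<^sub>f / c\<^sub>a; F = f / 2 in (sqrt (1 + G * F) - 1) / (sqrt (G * F) - F) = 1)"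

definition zero_gain_threshold :: "real \<Rightarrow> real \<Rightarrow> real" where
  "zero_gain_threshold c\<^sub>f c\<^sub>a = (THE f. is_zero_gain_threshold c\<^sub>f c\<^sub>a f)"

definition num_push_items :: "nat \<Rightarrow> (nat \<Rightarrow> real) \<Rightarrow> real \<Rightarrow> nat" where
  "num_push_items N y f = Max (insert 0 {n \<in> {1..N}. y n > f})"

lemma zero_gain_aux:
  fixes G x :: real
  assumes G: "G > 4" and x: "1/2 < x" "x < 1"
  shows "(sqrt (1 + G * x) - 1) / (sqrt (G * x) - x) = 1
           \<longleftrightarrow> sqrt x * (1 + 1 / (1 - x)) = 2 * sqrt G"
proof -
  define s where "s = sqrt x"
  define g where "g = sqrt G"
  have s: "s > 0" "x = s\<^sup>2" and g: "g > 2" "G = g\<^sup>2"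
    using assms real_less_rsqrt[of 2 G] by (auto simp: s_def g_def)
  have sx: "s < 1" using x(2) by (simp add: s_def)
  have Gx: "sqrt (G * x) = g * s" using s g by (simp add: real_sqrt_mult)
  have d: "g * s - x > 0"
  proof -
    have "s * s < g * s" using sx s g by (intro mult_strict_right_mono) auto
    thus ?thesis using s by (simp add: power2_eq_square)
  qed
  have "(sqrt (1 + G * x) - 1) / (sqrt (G * x) - x) = 1 \<longleftrightarrow> sqrt (1 + G * x) = 1 - x + g * s"
    unfolding Gx using d by (auto simp: field_simps)
  also have "\<dots> \<longleftrightarrow> 1 + G * x = (1 - x + g * s)\<^sup>2"
  proof -
    have "1 + G * x \<ge> 0" using G x by simp
    moreover have "1 - x + g * s \<ge> 0" using x s g by simp
    ultimately show ?thesis by (metis real_sqrt_pow2 real_sqrt_unique)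
  qed
  also have "\<dots> \<longleftrightarrow> s * (s * (2 - x)) = s * (2 * g * (1 - x))"
    unfolding s(2) g(2) by (simp only: power2_eq_square) algebra
  also have "\<dots> \<longleftrightarrow> s * (2 - x) = 2 * g * (1 - x)"
    using s by simp
  also have "\<dots> \<longleftrightarrow> s * (1 + 1 / (1 - x)) = 2 * g"
    using x by (simp add: field_simps)
  finally show ?thesis by (simp add: s_def g_def)
qed

lemma zero_gain_threshold_ex1:
  assumes "0 < c\<^sub>a" "c\<^sub>a < c\<^sub>f"
  shows "\<exists>!f. is_zero_gain_threshold c\<^sub>f c\<^sub>a f"
proof -
  define G where "G = 4 * c\<^sub>f / c\<^sub>a"
  define h where "h x = sqrt x * (1 + 1 / (1 - x))" for x :: real
  have G: "G > 4" using assms by (simp add: G_def field_simps)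
  have iff: "is_zero_gain_threshold c\<^sub>f c\<^sub>a f \<longleftrightarrow> 1 < f \<and> f < 2 \<and> h (f / 2) = 2 * sqrt G" for f
    using zero_gain_aux[OF G, of "f / 2"]
    by (auto simp: is_zero_gain_threshold_def Let_def G_def h_def)
  have mono: "h x < h y" if "1/2 < x" "x < y" "y < 1" for x y
    unfolding h_def using that
    by (intro mult_strict_mono add_strict_left_mono divide_strict_left_mono mult_pos_pos
        add_pos_nonneg) simp_all
  define k where "k x = sqrt x * (2 - x) - 2 * sqrt G * (1 - x)" for x :: real
  have "sqrt (1/2 :: real) < 1" by simp
  moreover have "sqrt G > 2" using G by (simp add: real_less_rsqrt)
  moreover have "k (1/2) = 3/2 * sqrt (1/2) - sqrt G" by (simp only: k_def) simp
  ultimately have k1: "k (1/2) < 0" by linarith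
  have k2: "k 1 > 0" by (simp add: k_def)
  have "continuous_on {1/2..1} k" unfolding k_def by (intro continuous_intros)
  hence "\<exists>x\<ge>1/2. x \<le> 1 \<and> k x = 0"
    using k1 k2 by (intro IVT') auto
  then obtain x where x: "1/2 \<le> x" "x \<le> 1" "k x = 0" by blast
  hence "x \<noteq> 1/2" "x \<noteq> 1" using k1 k2 by (metis less_irrefl)+
  with x have x': "1/2 < x" "x < 1" by linarith+
  have "1 + 1 / (1 - x) = (2 - x) / (1 - x)" using x' by (simp add: field_simps)
  hence "h x = sqrt x * (2 - x) / (1 - x)" by (simp add: h_def)
  also have "\<dots> = 2 * sqrt G * (1 - x) / (1 - x)" using x(3) by (simp add: k_def)
  also have "\<dots> = 2 * sqrt G" using x' by simp
  finally have "h x = 2 * sqrt G" .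
  hence "is_zero_gain_threshold c\<^sub>f c\<^sub>a (2 * x)" using x' by (simp add: iff)
  moreover have "f = f'"
    if "is_zero_gain_threshold c\<^sub>f c\<^sub>a f" "is_zero_gain_threshold c\<^sub>f c\<^sub>a f'" for f f'
    using mono[of "f/2" "f'/2"] mono[of "f'/2" "f/2"] that[unfolded iff] by linarith
  ultimately show ?thesis by blast
qed

end

theory Submission
  imports Defs
begin

text \<open>
  It suffices to bound, for each item, the difference between the expected cost on \<open>[0, T]\<close> and
  a multiple of \<open>T\<close> by a constant. The expected number of jumps of a Poisson process of rate \<open>r\<close>
  in \<open>[0, T]\<close> is \<open>r T\<close>, because the Erlang densities of the jump times add up to \<open>r\<close>.

  Push: the age is the number of updates modulo the threshold \<open>m\<close>. Integrating out the requests
  and using that the time with exactly \<open>j\<close> updates in \<open>[0, T]\<close> has expectation \<open>1/\<lambda>\<close> times the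
  probability that update \<open>j\<close> occurs before \<open>T\<close>, the expected cost becomes a sum over the updates
  before \<open>T\<close> with weights that are periodic in the index; summation by parts replaces the weights by
  their mean.

  Pull: integrating out the updates leaves a cost depending on the times since the last fetch, which
  form a Markov chain driven by the gaps between requests. With the relative value function of this
  chain as a potential, cost minus average telescopes in expectation.
\<close>

section \<open>Jump times of a Poisson process\<close>

text \<open>A bound that does not grow with \<open>T\<close> takes the place of renewal and ergodic
  theorems. Push fetches depend on the updates alone and pull fetches on the requests alone, so
  independence allows the other process to be averaged while the fetches stay fixed. All
  interchanges take place among nonnegative extended reals, where measurability suffices;
  integrability is read off from the final series.

  Fetch times are infima over a continuum of times. On almost every path they are first turned into
  one decision per jump, the form that can be summed and integrated.

  The potential V of the pull policy comes from its Bellman equation: V(a) + K \<tau> is the mean of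
  the cost plus the next potential after one exponential gap. Differentiating in a gives V'(a) = r K
  (\<tau> - a), with V(0) = 0. The obstacle is the horizon: whether request k falls before
  \<open>T\<close> depends on the very gap that this equation averages.\<close>

lemma sum_jump_gap: "(\<Sum>i\<le>k. jump_gap J i \<omega>) = J k \<omega>"
  by (induction k) (auto simp: jump_gap_def)

text \<open>This is the exponential series: \<open>erlang_density k\<close> has shape k + 1, so the
  powers start at 0 and the factor \<open>exp (- l * x)\<close> cancels.\<close>

lemma suminf_erlang_density:
  assumes "l > 0"
  shows "(\<Sum>k. ennreal (erlang_density k l x)) = ennreal l * indicator {0..} x"
proof (cases "x < 0")
  case False
  have "(\<lambda>k. (l * x) ^ k /\<^sub>R fact k) sums exp (l * x)"
    by (rule exp_converges)
  hence "(\<lambda>k. l * exp (- l * x) * ((l * x) ^ k /\<^sub>R fact k)) sums (l * exp (- l * x) * exp (l * x))"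
    by (rule sums_mult)
  also have "(\<lambda>k. l * exp (- l * x) * ((l * x) ^ k /\<^sub>R fact k)) = (\<lambda>k. erlang_density k l x)"
    using False by (simp add: erlang_density_def field_simps power_mult_distrib)
  also have "l * exp (- l * x) * exp (l * x) = l"
    by (simp add: exp_minus)
  finally have "(\<lambda>k. erlang_density k l x) sums l" .
  thus ?thesis
    using False assms by (simp add: suminf_ennreal_eq sums_iff)
qed (simp add: erlang_density_def)

locale poisson = prob_space M
  for M :: "'w measure" and J :: "nat \<Rightarrow> 'w \<Rightarrow> real" and r :: real +
  assumes poisson: "poisson_process M r J" and rate_pos: "r > 0"
begin

lemma gaps_indep: "indep_vars (\<lambda>_. borel) (jump_gap J) UNIV"
  and gap_distributed: "distributed M lborel (jump_gap J k) (exponential_density r)"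
  using poisson by (auto simp: poisson_process_def)

lemma gap_measurable [measurable]: "jump_gap J k \<in> borel_measurable M"
  using distributed_measurable[OF gap_distributed] by simp

lemma jump_measurable [measurable]: "J k \<in> borel_measurable M"
  by (subst sum_jump_gap[symmetric, abs_def]) measurable

lemma jump_distributed: "distributed M lborel (J k) (erlang_density k r)"
proof -
  have "distributed M lborel (\<lambda>\<omega>. \<Sum>i\<in>{..k}. jump_gap J i \<omega>) (erlang_density (card {..k} - 1) r)"
    using gap_distributed indep_vars_subset[OF gaps_indep] rate_pos
    by (intro exponential_distributed_sum) auto
  thus ?thesis by (simp add: sum_jump_gap)
qed

text \<open>Campbell's formula: the mean measure of the jumps is \<open>r\<close> times Lebesgue
  measure on the half line. Only the individual laws of the jump times enter, not their joint
  law.\<close>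

lemma nn_integral_jumps:
  assumes [measurable]: "g \<in> borel_measurable borel"
  shows "(\<integral>\<^sup>+\<omega>. (\<Sum>k. g (J k \<omega>)) \<partial>M) = ennreal r * (\<integral>\<^sup>+t\<in>{0..}. g t \<partial>lborel)"
proof -
  have "(\<integral>\<^sup>+\<omega>. (\<Sum>k. g (J k \<omega>)) \<partial>M) = (\<Sum>k. \<integral>\<^sup>+\<omega>. g (J k \<omega>) \<partial>M)"
    by (intro nn_integral_suminf) measurable
  also have "\<dots> = (\<Sum>k. \<integral>\<^sup>+t. ennreal (erlang_density k r t) * g t \<partial>lborel)"
    by (intro suminf_cong distributed_nn_integral[OF jump_distributed, symmetric]) simp
  also have "\<dots> = (\<integral>\<^sup>+t. (\<Sum>k. ennreal (erlang_density k r t) * g t) \<partial>lborel)"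
    by (intro nn_integral_suminf[symmetric]) measurable
  also have "\<dots> = (\<integral>\<^sup>+t. ennreal r * (g t * indicator {0..} t) \<partial>lborel)"
    by (intro nn_integral_cong) (simp add: suminf_erlang_density rate_pos ac_simps)
  also have "\<dots> = ennreal r * (\<integral>\<^sup>+t\<in>{0..}. g t \<partial>lborel)"
    by (intro nn_integral_cmult) measurable
  finally show ?thesis .
qed

lemma nn_integral_jumps_Ioc:
  assumes "0 \<le> s" "s \<le> t"
  shows "(\<integral>\<^sup>+\<omega>. (\<Sum>k. indicator {s<..t} (J k \<omega>)) \<partial>M) = ennreal (r * (t - s))"
proof -
  have "(\<integral>\<^sup>+x\<in>{0..}. indicator {s<..t} x \<partial>lborel) = (\<integral>\<^sup>+x. indicator {s<..t} x \<partial>lborel)"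
    using assms by (intro nn_integral_cong) (auto split: split_indicator)
  thus ?thesis
    using assms rate_pos by (subst nn_integral_jumps) (auto simp: ennreal_mult)
qed

text \<open>For \<open>T \<ge> 0\<close> this is a Poisson tail, the probability of more than
  \<open>k\<close> jumps up to \<open>T\<close>. It is the coefficient of update \<open>k\<close> in
  the push cost and controls the truncation at \<open>T\<close> in the pull cost.\<close>

definition reach :: "real \<Rightarrow> nat \<Rightarrow> real" where
  "reach T k = prob {\<omega> \<in> space M. J k \<omega> \<le> T}"

lemma AE_jump_pos: "AE \<omega> in M. J k \<omega> \<ge> 0"
  by (subst distributed_AE2[OF jump_distributed]) (auto simp: erlang_density_def)

lemma AE_gap_pos: "AE \<omega> in M. jump_gap J k \<omega> > 0"
proof -
  have "AE x in lborel. x \<noteq> (0::real)" by (rule AE_lborel_singleton)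
  thus ?thesis
    by (subst distributed_AE2[OF gap_distributed])
       (auto simp: exponential_density_def elim!: eventually_mono)
qed

lemma ennreal_reach: "ennreal (reach T k) = (\<integral>\<^sup>+\<omega>. indicator {0..T} (J k \<omega>) \<partial>M)"
proof -
  have "ennreal (reach T k) = emeasure M {\<omega> \<in> space M. J k \<omega> \<le> T}"
    by (simp add: reach_def emeasure_eq_measure)
  also have "\<dots> = (\<integral>\<^sup>+\<omega>. indicator {\<omega> \<in> space M. J k \<omega> \<le> T} \<omega> \<partial>M)"
    by simp
  also have "\<dots> = (\<integral>\<^sup>+\<omega>. indicator {..T} (J k \<omega>) \<partial>M)"
    by (intro nn_integral_cong) (auto split: split_indicator)
  also have "\<dots> = (\<integral>\<^sup>+\<omega>. indicator {0..T} (J k \<omega>) \<partial>M)"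
    using AE_jump_pos[of k]
    by (intro nn_integral_cong_AE) (auto elim!: eventually_mono split: split_indicator)
  finally show ?thesis .
qed

lemma sums_reach:
  assumes "T \<ge> 0" shows "reach T sums (r * T)"
proof -
  have "(\<Sum>k. ennreal (reach T k)) = (\<integral>\<^sup>+\<omega>. (\<Sum>k. indicator {0..T} (J k \<omega>)) \<partial>M)"
    by (subst nn_integral_suminf) (auto simp: ennreal_reach)
  also have "\<dots> = ennreal r * (\<integral>\<^sup>+x\<in>{0..}. indicator {0..T} x \<partial>lborel)"
    by (rule nn_integral_jumps) simp
  also have "(\<integral>\<^sup>+x\<in>{0..}. indicator {0..T} x \<partial>lborel) = (\<integral>\<^sup>+x. indicator {0..T} x \<partial>lborel)"
    by (intro nn_integral_cong) (auto split: split_indicator)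
  also have "ennreal r * \<dots> = ennreal (r * T)"
    using assms rate_pos by (simp add: ennreal_mult)
  finally have *: "(\<Sum>k. ennreal (reach T k)) = ennreal (r * T)" .
  have nn: "0 \<le> reach T k" for k by (simp add: reach_def)
  have "summable (reach T)" by (rule summable_suminf_not_top[OF nn]) (simp add: *)
  moreover from this have "ennreal (suminf (reach T)) = ennreal (r * T)"
    using * suminf_ennreal2[OF nn] by simp
  hence "suminf (reach T) = r * T"
    using rate_pos assms suminf_nonneg[OF \<open>summable (reach T)\<close> nn] by simp
  ultimately show ?thesis by (simp add: sums_iff)
qed

lemma reach_Suc_le: "reach T (Suc k) \<le> reach T k"
proof -
  have "AE \<omega> in M. J k \<omega> \<le> J (Suc k) \<omega>"
    using AE_gap_pos[of "Suc k"] by (auto elim!: eventually_mono simp: jump_gap_def)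
  thus ?thesis
    unfolding reach_def by (intro finite_measure_mono_AE) (auto elim!: eventually_mono)
qed

text \<open>The expected number of jumps in a bounded interval is finite, so almost surely a series
  of zeros and ones converges and its terms are eventually 0. Integer horizons keep the exceptional
  sets countable in number.\<close>

lemma AE_finite_jumps: "AE \<omega> in M. \<forall>T. finite {k. J k \<omega> \<le> T}"
proof -
  have "AE \<omega> in M. finite {k. J k \<omega> \<le> real n}" for n
  proof -
    have "AE \<omega> in M. (\<Sum>k. indicator {0<..real n} (J k \<omega>) :: ennreal) \<noteq> \<infinity>"
      using nn_integral_jumps_Ioc[of 0 "real n"]
      by (intro nn_integral_noteq_infinite) auto
    moreover have "AE \<omega> in M. \<forall>k. jump_gap J k \<omega> > 0"
      using AE_gap_pos by (simp add: AE_all_countable)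
    ultimately show ?thesis
    proof eventually_elim
      case (elim \<omega>)
      have pos: "J k \<omega> > 0" for k
        using elim(2) by (subst sum_jump_gap[symmetric]) (auto intro!: sum_pos)
      have "(\<Sum>k. indicator {0<..real n} (J k \<omega>) :: ennreal)
              = (\<Sum>k. ennreal (indicator {k. J k \<omega> \<le> real n} k))"
        using pos by (intro suminf_cong) (auto split: split_indicator)
      hence "summable (\<lambda>k. indicator {k. J k \<omega> \<le> real n} k :: real)"
        using elim(1) by (intro summable_suminf_not_top) auto
      hence "(\<lambda>k. indicator {k. J k \<omega> \<le> real n} k :: real) \<longlonglongrightarrow> 0"
        by (rule summable_LIMSEQ_zero)
      hence "eventually (\<lambda>k. indicator {k. J k \<omega> \<le> real n} k < (1::real)) sequentially"
        by (rule order_tendstoD) simp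
      then obtain N where N: "\<And>k. k \<ge> N \<Longrightarrow> indicator {k. J k \<omega> \<le> real n} k < (1::real)"
        by (auto simp: eventually_sequentially)
      have "{k. J k \<omega> \<le> real n} \<subseteq> {..<N}"
      proof
        fix k assume "k \<in> {k. J k \<omega> \<le> real n}"
        thus "k \<in> {..<N}" using N[of k] by (cases "k < N") auto
      qed
      thus ?case by (rule finite_subset) simp
    qed
  qed
  hence "AE \<omega> in M. \<forall>n. finite {k. J k \<omega> \<le> real n}"
    by (simp add: AE_all_countable)
  thus ?thesis
  proof eventually_elim
    case (elim \<omega>)
    show ?case
    proof
      fix T obtain n where "T \<le> real n" using real_arch_simple by blast
      thus "finite {k. J k \<omega> \<le> T}"
        by (intro finite_subset[OF _ elim[rule_format, of n]]) auto
    qed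
  qed
qed

end

section \<open>Fetch times and costs along a path\<close>

text \<open>The almost sure properties on which the pathwise formulas rest. Positivity of the first
  jump lets the initial time 0 act like a fetch that precedes all jumps.\<close>

definition jump_path :: "(nat \<Rightarrow> real) \<Rightarrow> bool" where
  "jump_path v \<longleftrightarrow> 0 < v 0 \<and> strict_mono v \<and> (\<forall>T. finite {k. v k \<le> T})"

lemma (in poisson) AE_jump_path: "AE \<omega> in M. jump_path (\<lambda>k. J k \<omega>)"
proof -
  have "AE \<omega> in M. \<forall>k. jump_gap J k \<omega> > 0"
    using AE_gap_pos by (simp add: AE_all_countable)
  with AE_finite_jumps show ?thesis
  proof eventually_elim
    case (elim \<omega>)
    have "J 0 \<omega> > 0" "J k \<omega> < J (Suc k) \<omega>" for k
      using elim(2)[rule_format, of 0] elim(2)[rule_format, of "Suc k"]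
      by (simp_all add: jump_gap_def)
    thus ?case using elim(1) by (auto simp: jump_path_def strict_mono_Suc_iff)
  qed
qed

definition count_jumps :: "(nat \<Rightarrow> real) \<Rightarrow> real \<Rightarrow> nat" where
  "count_jumps v t = card {k. v k \<le> t}"

context
  fixes v :: "nat \<Rightarrow> real"
  assumes v: "jump_path v"
begin

lemma jump_path_less_iff: "v i < v j \<longleftrightarrow> i < j"
  and jump_path_le_iff: "v i \<le> v j \<longleftrightarrow> i \<le> j"
  and jump_path_pos: "0 < v i"
  and finite_jumps_le: "finite {k. v k \<le> t}"
proof -
  show "v i < v j \<longleftrightarrow> i < j" "v i \<le> v j \<longleftrightarrow> i \<le> j" "finite {k. v k \<le> t}"
    using v by (auto simp: jump_path_def strict_mono_less strict_mono_less_eq)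
  have "v 0 \<le> v i" using v by (simp add: jump_path_def strict_mono_less_eq)
  thus "0 < v i" using v by (simp add: jump_path_def)
qed

text \<open>The indices of the jumps up to \<open>t\<close> form an initial segment of the naturals.
  The equivalence translates comparisons of times into comparisons of indices.\<close>

lemma less_count_jumps_iff: "k < count_jumps v t \<longleftrightarrow> v k \<le> t"
proof -
  have "\<exists>n. {k. v k \<le> t} = {..<n}"
  proof -
    have ex: "\<exists>n. \<not> v n \<le> t"
      using finite_jumps_le[of t] by (metis (mono_tags) finite_nat_set_iff_bounded less_irrefl mem_Collect_eq)
    define n where "n = (LEAST n. \<not> v n \<le> t)"
    have "\<not> v n \<le> t" using ex unfolding n_def by (rule LeastI_ex)
    moreover have "v k \<le> t" if "k < n" for k using not_less_Least[OF that[unfolded n_def]] by simp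
    moreover have "v n \<le> v k" if "n \<le> k" for k using that by (simp add: jump_path_le_iff)
    ultimately have "{k. v k \<le> t} = {..<n}" by (force simp: not_le)
    thus ?thesis ..
  qed
  then obtain n where n: "{k. v k \<le> t} = {..<n}" ..
  thus ?thesis unfolding count_jumps_def by (metis card_lessThan lessThan_iff mem_Collect_eq)
qed

lemma count_jumps_le_iff: "count_jumps v t \<le> k \<longleftrightarrow> t < v k"
  using less_count_jumps_iff[of k t] by linarith

lemma ennreal_sum_jumps:
  assumes "\<And>k. f k \<ge> 0"
  shows "ennreal (\<Sum>k | v k \<in> {0..T}. f k) = (\<Sum>k. ennreal (f k) * indicator {0..T} (v k))"
proof -
  have fin: "finite {k. v k \<in> {0..T}}"
    by (rule finite_subset[OF _ finite_jumps_le[of T]]) auto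
  have "(\<Sum>k. ennreal (f k) * indicator {0..T} (v k))
          = (\<Sum>k | v k \<in> {0..T}. ennreal (f k) * indicator {0..T} (v k))"
    using fin by (intro suminf_finite) auto
  also have "\<dots> = (\<Sum>k | v k \<in> {0..T}. ennreal (f k))" by (intro sum.cong) auto
  also have "\<dots> = ennreal (\<Sum>k | v k \<in> {0..T}. f k)" using assms by simp
  finally show ?thesis ..
qed

lemma ennreal_card_jumps:
  "ennreal (real (card {j. v j \<in> {s<..t}})) = (\<Sum>j. indicator {s<..t} (v j))"
proof -
  have fin: "finite {j. v j \<in> {s<..t}}"
    by (rule finite_subset[OF _ finite_jumps_le[of t]]) auto
  have "(\<Sum>j. indicator {s<..t} (v j) :: ennreal) = (\<Sum>j | v j \<in> {s<..t}. indicator {s<..t} (v j))"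
    using fin by (intro suminf_finite) auto
  also have "\<dots> = (\<Sum>j | v j \<in> {s<..t}. 1)" by (intro sum.cong) auto
  also have "\<dots> = ennreal (real (card {j. v j \<in> {s<..t}}))" by (simp add: ennreal_of_nat_eq_real_of_nat)
  finally show ?thesis ..
qed

text \<open>At most one of the intervals between consecutive jumps contains \<open>t\<close>. The
  series is measurable jointly in path and time and can be integrated termwise. Truncated
  subtraction makes the interval for \<open>j = 0\<close> the empty \<open>{v 0..<v 0}\<close>,
  hence the premise \<open>f 0 = 0\<close>.\<close>

lemma suminf_count_jumps:
  assumes "f 0 = 0"
  shows "(\<Sum>j. f j * indicator {v (j - 1)..<v j} t) = (f (count_jumps v t) :: ennreal)"
proof -
  let ?n = "count_jumps v t"
  have "(\<Sum>j. f j * indicator {v (j - 1)..<v j} t) = (\<Sum>j\<in>{?n}. f j * indicator {v (j - 1)..<v j} t)"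
  proof (rule suminf_finite)
    fix j assume "j \<notin> {?n}"
    hence "f j = 0 \<or> j - 1 \<ge> ?n \<or> j < ?n" using assms by (cases j) auto
    thus "f j * indicator {v (j - 1)..<v j} t = 0"
      by (auto simp: count_jumps_le_iff less_count_jumps_iff)
  qed simp
  also have "\<dots> = f ?n"
  proof (cases "?n = 0")
    case False
    hence "?n - 1 < ?n" by simp
    hence "v (?n - 1) \<le> t" by (simp only: less_count_jumps_iff)
    moreover have "t < v ?n" by (simp flip: count_jumps_le_iff)
    ultimately show ?thesis by simp
  qed (use assms in simp)
  finally show ?thesis .
qed

text \<open>The updates after fetch time \<open>i\<close> are those of index at least
  \<open>i * m\<close>, so the due times form a closed ray and their infimum is attained at its left
  end. Indices start at 0, hence the \<open>- 1\<close>.\<close>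

lemma fetch_time_push:
  assumes "m \<ge> 1"
  defines "due \<equiv> \<lambda>s t. real (card {j. v j \<in> {s<..t}}) \<ge> real m"
  shows "fetch_time due (Suc i) = v (Suc i * m - 1)"
proof (induction i rule: less_induct)
  case (less i)
  let ?s = "fetch_time due i"
  have s: "v j > ?s \<longleftrightarrow> j \<ge> i * m" for j
  proof (cases i)
    case (Suc i')
    have "?s = v (i * m - 1)" using less[of i'] Suc by simp
    moreover have "i * m \<ge> 1" using Suc assms by simp
    ultimately show ?thesis using jump_path_less_iff[of "i * m - 1" j] by linarith
  qed (simp add: jump_path_pos)
  have "{j. v j \<in> {?s<..t}} = {i * m..<count_jumps v t}" for t
    by (auto simp: s less_count_jumps_iff)
  moreover have "m \<le> count_jumps v t - i * m \<longleftrightarrow> v (Suc i * m - 1) \<le> t" for t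
    using assms(1) by (subst less_count_jumps_iff[symmetric]) auto
  ultimately have "due ?s t \<longleftrightarrow> v (Suc i * m - 1) \<le> t" for t
    by (simp add: due_def)
  moreover have "?s < v (Suc i * m - 1)" using assms(1) by (subst s) simp
  ultimately have "{t. ?s < t \<and> due ?s t} = {v (Suc i * m - 1)..}" by auto
  thus ?case by simp
qed

lemma push_fetches_eq:
  assumes "m \<ge> 1"
  shows "push_fetches (real m) v = v ` {j. m dvd Suc j}"
proof -
  have "push_fetches (real m) v = range (\<lambda>i. v (Suc i * m - 1))"
    unfolding push_fetches_def fetches_def using fetch_time_push[OF assms] by simp
  also have "\<dots> = v ` range (\<lambda>i. Suc i * m - 1)" by auto
  also have "range (\<lambda>i. Suc i * m - 1) = {j. m dvd Suc j}"
  proof safe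
    fix i show "m dvd Suc (Suc i * m - 1)" using assms by (simp add: Suc_diff_1)
  next
    fix j assume "m dvd Suc j"
    then obtain q where q: "Suc j = m * q" by blast
    then obtain i where "q = Suc i" by (cases q) auto
    hence "j = Suc i * m - 1" using q by (simp add: mult.commute)
    thus "j \<in> range (\<lambda>i. Suc i * m - 1)" by blast
  qed
  finally show ?thesis .
qed

text \<open>The pending updates are the indices from the last multiple of \<open>m\<close> up to the
  count: those below it are covered by the fetch at index \<open>m * (?n div m) - 1\<close>, and the
  next fetch index has not been reached.\<close>

lemma age_push:
  assumes "m \<ge> 1"
  shows "age v (push_fetches (real m) v) t = count_jumps v t mod m"
proof -
  let ?n = "count_jumps v t"
  have "{j. v j \<le> t \<and> push_fetches (real m) v \<inter> {v j..t} = {}} = {m * (?n div m)..<?n}"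
  proof (intro set_eqI iffI)
    fix j assume "j \<in> {j. v j \<le> t \<and> push_fetches (real m) v \<inter> {v j..t} = {}}"
    hence j: "j < ?n" and e: "\<And>i. m dvd Suc i \<Longrightarrow> j \<le> i \<Longrightarrow> i \<ge> ?n"
      using assms by (auto simp: push_fetches_eq less_count_jumps_iff jump_path_le_iff count_jumps_le_iff)
    have "m * (?n div m) \<le> j"
    proof (rule ccontr)
      assume a: "\<not> ?thesis"
      hence "Suc (m * (?n div m) - 1) = m * (?n div m)" by simp
      hence "m * (?n div m) - 1 \<ge> ?n" using a by (intro e) auto
      moreover have "m * (?n div m) \<le> ?n" by simp
      ultimately show False using a by linarith
    qed
    thus "j \<in> {m * (?n div m)..<?n}" using j by simp
  next
    fix j assume j: "j \<in> {m * (?n div m)..<?n}"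
    have False if i: "i < ?n" "j \<le> i" "m dvd Suc i" for i
    proof -
      obtain q where q: "Suc i = m * q" using i(3) by blast
      have "m * (?n div m) \<le> j" using j by simp
      hence "m * (?n div m) < m * q" using q i(2) by linarith
      hence "?n div m < q" by simp
      moreover have "q \<le> ?n div m"
        using i(1) q assms by (metis Suc_leI div_le_mono nonzero_mult_div_cancel_left not_one_le_zero)
      ultimately show False by simp
    qed
    thus "j \<in> {j. v j \<le> t \<and> push_fetches (real m) v \<inter> {v j..t} = {}}"
      using j assms by (auto simp: push_fetches_eq less_count_jumps_iff jump_path_le_iff)
  qed
  thus ?thesis by (simp add: age_def minus_mult_div_eq_mod)
qed

end

text \<open>At a fetch time the age is 0, so the requests excluded by \<open>item_cost\<close> may
  be put back into the sum. Both policies fit this form, with \<open>v\<close> the updates for push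
  and the requests for pull.\<close>

lemma item_cost_image:
  assumes v: "jump_path v" and R: "jump_path R"
  shows "item_cost c\<^sub>f c\<^sub>a U R (v ` {j. P j}) T =
           (\<Sum>j | v j \<in> {0..T}. c\<^sub>f * of_bool (P j)) +
           (\<Sum>k | R k \<in> {0..T}. c\<^sub>a * real (age U (v ` {j. P j}) (R k)))"
proof -
  let ?S = "v ` {j. P j}"
  have fin: "finite {k. w k \<in> {0..T}}" if "jump_path w" for w
    by (rule finite_subset[OF _ finite_jumps_le[OF that, of T]]) auto
  have inj: "inj_on v A" for A by (rule inj_onI) (metis jump_path_le_iff[OF v] antisym order_refl)
  have "?S \<inter> {0..T} = v ` {j. v j \<in> {0..T} \<and> P j}" by auto
  hence "card (?S \<inter> {0..T}) = card {j. v j \<in> {0..T} \<and> P j}"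
    by (simp only: card_image[OF inj])
  also have "real \<dots> = (\<Sum>j | v j \<in> {0..T}. of_bool (P j))"
    using fin[OF v] by (simp add: of_bool_def sum.If_cases Int_def)
  finally have "real (card (?S \<inter> {0..T})) = (\<Sum>j | v j \<in> {0..T}. of_bool (P j))" .
  moreover have "(\<Sum>k | R k \<in> {0..T} \<and> R k \<notin> ?S. c\<^sub>a * real (age U ?S (R k)))
          = (\<Sum>k | R k \<in> {0..T}. c\<^sub>a * real (age U ?S (R k)))"
  proof (rule sum.mono_neutral_left[OF fin[OF R]])
    have "age U ?S t = 0" if "t \<in> ?S" for t
    proof -
      have "{j. U j \<le> t \<and> ?S \<inter> {U j..t} = {}} = {}" using that by auto
      thus ?thesis by (simp only: age_def card.empty)
    qed
    thus "\<forall>k\<in>{k. R k \<in> {0..T}} - {k. R k \<in> {0..T} \<and> R k \<notin> ?S}.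
            c\<^sub>a * real (age U ?S (R k)) = 0"
      by auto
  qed auto
  ultimately show ?thesis by (simp add: item_cost_def sum_distrib_left)
qed

lemma item_cost_push:
  assumes "jump_path v" "m \<ge> 1" "jump_path R"
  shows "item_cost c\<^sub>f c\<^sub>a v R (push_fetches (real m) v) T =
           (\<Sum>j | v j \<in> {0..T}. c\<^sub>f * of_bool (m dvd Suc j)) +
           (\<Sum>k | R k \<in> {0..T}. c\<^sub>a * real (count_jumps v (R k) mod m))"
  unfolding age_push[OF assms(1,2), symmetric] push_fetches_eq[OF assms(1,2)]
  by (rule item_cost_image[OF assms(1,3)])

text \<open>The time of the last fetch before request \<open>k\<close> is handled, with the initial
  value 0 when there was none. The recursion runs over requests instead of fetches, which makes the
  policy a decision at each request.\<close>

primrec last_fetch :: "real \<Rightarrow> (nat \<Rightarrow> real) \<Rightarrow> nat \<Rightarrow> real" where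
  "last_fetch \<tau> v 0 = 0"
| "last_fetch \<tau> v (Suc k) = (if v k - last_fetch \<tau> v k > \<tau> then v k else last_fetch \<tau> v k)"

definition is_fetch :: "real \<Rightarrow> (nat \<Rightarrow> real) \<Rightarrow> nat \<Rightarrow> bool" where
  "is_fetch \<tau> v k \<longleftrightarrow> v k - last_fetch \<tau> v k > \<tau>"

lemma last_fetch_Suc:
  "last_fetch \<tau> v (Suc k) = (if is_fetch \<tau> v k then v k else last_fetch \<tau> v k)"
  by (simp add: is_fetch_def)

declare last_fetch.simps(2) [simp del]

context
  fixes v :: "nat \<Rightarrow> real" and \<tau> :: real
  assumes v: "jump_path v" and \<tau>: "\<tau> \<ge> 0"
begin

lemma last_fetch_nonneg: "0 \<le> last_fetch \<tau> v k"
  by (induction k) (auto simp: last_fetch_Suc less_imp_le jump_path_pos[OF v])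

text \<open>Guarantees that no request before \<open>k\<close> counts as due from the current last
  fetch, so the search for the next fetch may start at \<open>k\<close>.\<close>

lemma jump_le_last_fetch: "j < k \<Longrightarrow> v j \<le> last_fetch \<tau> v k + \<tau>"
proof (induction k)
  case (Suc k)
  show ?case
  proof (cases "j = k")
    case True
    thus ?thesis using \<tau> by (auto simp: last_fetch_Suc is_fetch_def)
  next
    case False
    with Suc have "v j \<le> last_fetch \<tau> v k + \<tau>" by simp
    thus ?thesis using \<tau> by (auto simp: last_fetch_Suc is_fetch_def)
  qed
qed simp

lemma is_fetch_le_last_fetch: "is_fetch \<tau> v j \<Longrightarrow> j < k \<Longrightarrow> v j \<le> last_fetch \<tau> v k"
proof (induction k)
  case (Suc k)
  show ?case
  proof (cases "j = k")
    case False
    with Suc have "v j \<le> last_fetch \<tau> v k" by simp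
    moreover have "v j < v k" using False Suc by (simp add: jump_path_less_iff[OF v])
    ultimately show ?thesis by (simp add: last_fetch_Suc)
  qed (use Suc in \<open>simp add: last_fetch_Suc\<close>)
qed simp

lemma last_fetch_cases: "last_fetch \<tau> v k = 0 \<or> (\<exists>j<k. is_fetch \<tau> v j \<and> last_fetch \<tau> v k = v j)"
  by (induction k) (auto simp: last_fetch_Suc less_Suc_eq)

text \<open>Local finiteness provides a first request later than the last fetch plus \<tau>, and the
  infimum is attained there. The premise keeps this request from preceding \<open>k\<close>, and
  until it is handled \<open>last_fetch\<close> does not change.\<close>

lemma next_fetch:
  assumes k: "\<And>j. j < k \<Longrightarrow> v j \<le> last_fetch \<tau> v k + \<tau>"
  obtains i where "k \<le> i" "is_fetch \<tau> v i" "last_fetch \<tau> v i = last_fetch \<tau> v k"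
    "Inf {t. last_fetch \<tau> v k < t \<and> t \<in> range v \<and> t - last_fetch \<tau> v k > \<tau>} = v i"
proof -
  let ?s = "last_fetch \<tau> v k"
  have ex: "\<exists>i. v i > ?s + \<tau>"
    using less_count_jumps_iff[OF v, of _ "?s + \<tau>"] by (meson less_irrefl not_le)
  define i where "i = (LEAST i. v i > ?s + \<tau>)"
  have i: "v i > ?s + \<tau>" unfolding i_def using ex by (rule LeastI_ex)
  have less: "v j \<le> ?s + \<tau>" if "j < i" for j
    using not_less_Least[OF that[unfolded i_def]] by simp
  have "k \<le> i" using k[of i] i by (meson not_le)
  have same: "last_fetch \<tau> v j = ?s" if "k \<le> j" "j \<le> i" for j
    using that
  proof (induction j rule: dec_induct)
    case (step j)
    thus ?case using less[of j] by (simp add: last_fetch_Suc is_fetch_def)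
  qed simp
  have L: "last_fetch \<tau> v i = ?s" by (rule same[OF \<open>k \<le> i\<close> order_refl])
  have "Inf {t. ?s < t \<and> t \<in> range v \<and> t - ?s > \<tau>} = v i"
  proof (rule cInf_eq_minimum)
    show "v i \<in> {t. ?s < t \<and> t \<in> range v \<and> t - ?s > \<tau>}" using i \<tau> by auto
    fix t assume "t \<in> {t. ?s < t \<and> t \<in> range v \<and> t - ?s > \<tau>}"
    then obtain j where "t = v j" "v j > ?s + \<tau>" by auto
    moreover from this have "i \<le> j" using less[of j] by (meson not_le)
    ultimately show "v i \<le> t" by (simp add: jump_path_le_iff[OF v])
  qed
  moreover have "is_fetch \<tau> v i" using i L by (simp add: is_fetch_def)
  ultimately show ?thesis by (rule that[OF \<open>k \<le> i\<close> _ L, rotated])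
qed

text \<open>Matches two recursions, \<open>le\<close> over fetches and \<open>ge\<close> over
  requests. \<open>ge\<close> follows \<open>last_fetch\<close>, so that its initial value 0, which
  is not a fetch, has the counterpart \<open>fetch_time due 0\<close>; positivity of the request
  times excludes that case afterwards.\<close>

lemma pull_fetches_eq: "pull_fetches \<tau> v = v ` {k. is_fetch \<tau> v k}"
proof -
  define due where "due = (\<lambda>s t. t \<in> range v \<and> t - s > \<tau>)"
  have due_Suc: "fetch_time due (Suc i) = Inf {t. s < t \<and> t \<in> range v \<and> t - s > \<tau>}"
    if "fetch_time due i = s" for i s
    using that by (simp add: due_def)
  have le: "\<exists>k. is_fetch \<tau> v k \<and> fetch_time due (Suc i) = v k" for i
  proof (induction i)
    case 0
    obtain k where "is_fetch \<tau> v k" "Inf {t. 0 < t \<and> t \<in> range v \<and> t - 0 > \<tau>} = v k"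
      using next_fetch[of 0] by (auto simp del: diff_0_right)
    thus ?case using due_Suc[of 0 0] by (auto simp del: fetch_time.simps(2))
  next
    case (Suc i)
    then obtain k where k: "is_fetch \<tau> v k" "fetch_time due (Suc i) = v k" by blast
    hence L: "last_fetch \<tau> v (Suc k) = v k" by (simp add: last_fetch_Suc)
    obtain l where "is_fetch \<tau> v l" "Inf {t. v k < t \<and> t \<in> range v \<and> t - v k > \<tau>} = v l"
      using next_fetch[OF jump_le_last_fetch, of "Suc k"] L by metis
    thus ?case using due_Suc[OF k(2)] by (auto simp del: fetch_time.simps(2))
  qed
  have ge: "\<exists>i. fetch_time due i = last_fetch \<tau> v k" for k
  proof (induction k)
    case 0
    show ?case by (rule exI[of _ 0]) simp
  next
    case (Suc k)
    show ?case
    proof (cases "is_fetch \<tau> v k")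
      case True
      from Suc.IH obtain i where i: "fetch_time due i = last_fetch \<tau> v k" ..
      obtain l where l: "k \<le> l" "last_fetch \<tau> v l = last_fetch \<tau> v k"
          "fetch_time due (Suc i) = v l"
        using next_fetch[OF jump_le_last_fetch, of k] due_Suc[OF i] by metis
      \<comment> \<open>If \<open>k < l\<close>, the fetch at request \<open>k\<close> would already
        show in \<open>last_fetch \<tau> v l\<close>, which still has its value from before request
        \<open>k\<close>.\<close>
      have "l = k"
      proof (rule ccontr)
        assume "l \<noteq> k"
        hence "v k \<le> last_fetch \<tau> v l" using True l by (intro is_fetch_le_last_fetch) auto
        thus False using True \<tau> l by (simp add: is_fetch_def)
      qed
      hence "fetch_time due (Suc i) = last_fetch \<tau> v (Suc k)"
        using l True by (simp add: last_fetch_Suc del: fetch_time.simps)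
      thus ?thesis ..
    qed (use Suc.IH in \<open>simp add: last_fetch_Suc\<close>)
  qed
  have "\<exists>i. fetch_time due (Suc i) = v k" if k: "is_fetch \<tau> v k" for k
  proof -
    obtain i where i: "fetch_time due i = v k"
      using ge[of "Suc k"] k by (auto simp: last_fetch_Suc)
    hence "i \<noteq> 0" using jump_path_pos[OF v, of k] by (auto intro: ccontr)
    thus ?thesis using i by (cases i) auto
  qed
  with le have "range (\<lambda>i. fetch_time due (Suc i)) = v ` {k. is_fetch \<tau> v k}"
    by (auto simp: image_iff simp del: fetch_time.simps(2)) metis+
  thus ?thesis by (simp add: pull_fetches_def fetches_def due_def)
qed

text \<open>The index is \<open>Suc k\<close> because the fetch decided at request \<open>k\<close>
  already counts: a fetching request gets an empty interval and age 0.\<close>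

lemma age_pull:
  assumes U: "jump_path U"
  shows "age U (pull_fetches \<tau> v) (v k) = card {j. U j \<in> {last_fetch \<tau> v (Suc k)<..v k}}"
proof -
  let ?S = "pull_fetches \<tau> v" and ?L = "last_fetch \<tau> v (Suc k)"
  have "?S \<inter> {U j..v k} = {} \<longleftrightarrow> ?L < U j" for j
  proof
    assume e: "?S \<inter> {U j..v k} = {}"
    show "?L < U j"
    proof (cases "?L = 0")
      case False
      then obtain i where "i < Suc k" "is_fetch \<tau> v i" "?L = v i"
        using last_fetch_cases[of "Suc k"] by auto
      moreover from this have "v i \<in> ?S" "v i \<le> v k"
        by (auto simp: pull_fetches_eq jump_path_le_iff[OF v])
      ultimately show ?thesis using e by force
    qed (simp add: jump_path_pos[OF U])
  next
    assume L: "?L < U j"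
    have False if "is_fetch \<tau> v i" "U j \<le> v i" "v i \<le> v k" for i
    proof -
      have "i < Suc k" using that by (simp add: jump_path_le_iff[OF v])
      with that have "v i \<le> ?L" by (intro is_fetch_le_last_fetch)
      with L that show False by simp
    qed
    thus "?S \<inter> {U j..v k} = {}" by (auto simp: pull_fetches_eq)
  qed
  hence "{j. U j \<le> v k \<and> ?S \<inter> {U j..v k} = {}} = {j. U j \<in> {?L<..v k}}" by auto
  thus ?thesis by (simp only: age_def)
qed

lemma item_cost_pull:
  assumes U: "jump_path U"
  shows "item_cost c\<^sub>f c\<^sub>a U v (pull_fetches \<tau> v) T =
           (\<Sum>k | v k \<in> {0..T}. c\<^sub>f * of_bool (is_fetch \<tau> v k) +
              c\<^sub>a * real (card {j. U j \<in> {last_fetch \<tau> v (Suc k)<..v k}}))"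
  unfolding sum.distrib age_pull[OF U, symmetric] pull_fetches_eq
  by (rule item_cost_image[OF v v])

end

section \<open>Measurability of the cost\<close>

text \<open>
  \<open>M\<close> need not be complete, so costs have to be measurable on every path, also where the jump
  times are unordered or accumulate and the characterizations above fail. The point is that the
  infimum over times in \<open>fetch_time\<close> can be taken over the countably many jump times.
\<close>

lemma borel_measurable_real_card:
  fixes P :: "nat \<Rightarrow> 'w \<Rightarrow> bool"
  assumes "\<And>j. Measurable.pred M (P j)"
  shows "(\<lambda>\<omega>. real (card {j. P j \<omega>})) \<in> borel_measurable M"
proof -
  have "(\<lambda>\<omega>. card {j. P j \<omega>}) \<in> measurable M (count_space UNIV)"
    using assms by (intro measurable_card) (simp add: pred_def)
  thus ?thesis by measurable
qed

text \<open>On reals \<open>Inf {}\<close> is a fixed but unspecified value, so emptiness must be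
  split off as a measurable event: a nonempty set has an element below some natural number.\<close>

lemma borel_measurable_Inf_real:
  fixes S :: "'w \<Rightarrow> real set"
  assumes bdd: "\<And>\<omega>. bdd_below (S \<omega>)"
    and [measurable]: "\<And>a. Measurable.pred M (\<lambda>\<omega>. \<exists>t\<in>S \<omega>. t < a)"
  shows "(\<lambda>\<omega>. Inf (S \<omega>)) \<in> borel_measurable M"
  unfolding borel_measurable_iff_less
proof
  fix a
  have "Inf (S \<omega>) < a \<longleftrightarrow> (if \<exists>n::nat. \<exists>t\<in>S \<omega>. t < real n then \<exists>t\<in>S \<omega>. t < a else Inf {} < a)" for \<omega>
  proof (cases "S \<omega> = {}")
    case False
    hence "\<exists>n::nat. \<exists>t\<in>S \<omega>. t < real n" using reals_Archimedean2 by blast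
    thus ?thesis using cInf_less_iff[OF False bdd] by simp
  qed simp
  moreover have "Measurable.pred M
      (\<lambda>\<omega>. if \<exists>n::nat. \<exists>t\<in>S \<omega>. t < real n then \<exists>t\<in>S \<omega>. t < a else Inf {} < a)"
    by measurable
  ultimately show "{\<omega> \<in> space M. Inf (S \<omega>) < a} \<in> sets M"
    by (simp add: pred_def)
qed

text \<open>The assumption allows a random \<open>s\<close> because the induction applies it to the
  previous fetch time.\<close>

lemma borel_measurable_fetch_time:
  assumes "\<And>s a. s \<in> borel_measurable M \<Longrightarrow>
    Measurable.pred M (\<lambda>\<omega>. \<exists>t. s \<omega> < t \<and> due \<omega> (s \<omega>) t \<and> t < (a::real))"
  shows "(\<lambda>\<omega>. fetch_time (due \<omega>) i) \<in> borel_measurable M"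
proof (induction i)
  case (Suc i)
  have "(\<lambda>\<omega>. Inf {t. fetch_time (due \<omega>) i < t \<and> due \<omega> (fetch_time (due \<omega>) i) t}) \<in> borel_measurable M"
  proof (rule borel_measurable_Inf_real)
    show "bdd_below {t. fetch_time (due \<omega>) i < t \<and> due \<omega> (fetch_time (due \<omega>) i) t}" for \<omega>
      by (intro bdd_belowI[of _ "fetch_time (due \<omega>) i"]) auto
    show "Measurable.pred M (\<lambda>\<omega>. \<exists>t\<in>{t. fetch_time (due \<omega>) i < t \<and>
            due \<omega> (fetch_time (due \<omega>) i) t}. t < a)" for a
      using assms[OF Suc, of a] by (simp add: Bex_def conj_assoc)
  qed
  thus ?case by simp
qed simp

text \<open>On exceptional paths fetch times may repeat. Representing each value by its first index
  turns the cardinality into a count over naturals.\<close>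

lemma card_range_Int:
  fixes f :: "nat \<Rightarrow> 'b"
  shows "card (range f \<inter> A) = card {i. f i \<in> A \<and> (\<forall>j<i. f j \<noteq> f i)}"
proof -
  have "inj_on f {i. f i \<in> A \<and> (\<forall>j<i. f j \<noteq> f i)}"
    by (rule inj_onI) (metis (mono_tags, lifting) linorder_neqE_nat mem_Collect_eq)
  moreover have "range f \<inter> A = f ` {i. f i \<in> A \<and> (\<forall>j<i. f j \<noteq> f i)}"
  proof safe
    fix i assume "f i \<in> A"
    define k where "k = (LEAST k. f k = f i)"
    have "f k = f i" unfolding k_def by (rule LeastI) simp
    moreover have "f j \<noteq> f i" if "j < k" for j using not_less_Least[OF that[unfolded k_def]] .
    ultimately have "f i = f k \<and> f k \<in> A \<and> (\<forall>j<k. f j \<noteq> f k)" using \<open>f i \<in> A\<close> by simp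
    thus "f i \<in> f ` {i. f i \<in> A \<and> (\<forall>j<i. f j \<noteq> f i)}" by blast
  qed auto
  ultimately show ?thesis by (simp add: card_image)
qed

lemma borel_measurable_item_cost:
  assumes [measurable]: "\<And>k. U k \<in> borel_measurable M" "\<And>k. R k \<in> borel_measurable M"
    and due: "\<And>s a. s \<in> borel_measurable M \<Longrightarrow>
      Measurable.pred M (\<lambda>\<omega>. \<exists>t. s \<omega> < t \<and> due \<omega> (s \<omega>) t \<and> t < (a::real))"
  shows "(\<lambda>\<omega>. item_cost c\<^sub>f c\<^sub>a (\<lambda>k. U k \<omega>) (\<lambda>k. R k \<omega>) (fetches (due \<omega>)) T) \<in> borel_measurable M"
proof -
  define x where "x i \<omega> = fetch_time (due \<omega>) (Suc i)" for i \<omega>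
  have [measurable]: "x i \<in> borel_measurable M" for i
    unfolding x_def[abs_def] by (rule borel_measurable_fetch_time[OF due])
  have S: "fetches (due \<omega>) = range (\<lambda>i. x i \<omega>)" for \<omega>
    by (simp only: fetches_def x_def)
  have [measurable]: "(\<lambda>\<omega>. real (card (fetches (due \<omega>) \<inter> {0..T}))) \<in> borel_measurable M"
    unfolding S card_range_Int by (intro borel_measurable_real_card) measurable
  define g where "g k \<omega> = c\<^sub>a * real (age (\<lambda>k. U k \<omega>) (fetches (due \<omega>)) (R k \<omega>))" for k \<omega>
  have "range (\<lambda>i. x i \<omega>) \<inter> {s..t} = {} \<longleftrightarrow> (\<forall>i. \<not> (s \<le> x i \<omega> \<and> x i \<omega> \<le> t))" for \<omega> s t
    by (auto simp: disjoint_iff)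
  hence "g k = (\<lambda>\<omega>. c\<^sub>a * real (card {j. U j \<omega> \<le> R k \<omega> \<and> (\<forall>i. \<not> (U j \<omega> \<le> x i \<omega> \<and> x i \<omega> \<le> R k \<omega>))}))" for k
    by (simp only: g_def[abs_def] age_def S)
  hence [measurable]: "g k \<in> borel_measurable M" for k
    by (simp only:) (intro borel_measurable_times borel_measurable_const borel_measurable_real_card, measurable)
  define K where "K \<omega> = {k. R k \<omega> \<in> {0..T} \<and> (\<forall>i. R k \<omega> \<noteq> x i \<omega>)}" for \<omega>
  have K [measurable]: "Measurable.pred M (\<lambda>\<omega>. k \<in> K \<omega>)" for k
    unfolding K_def mem_Collect_eq by measurable
  have [measurable]: "Measurable.pred M (\<lambda>\<omega>. finite (K \<omega>))"
    using K by (intro measurable_finite) (simp add: pred_def)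
  \<comment> \<open>On exceptional paths \<open>K \<omega>\<close> may be infinite, and then
    \<open>sum\<close> is 0 by convention.\<close>
  have "sum (\<lambda>k. g k \<omega>) (K \<omega>) = (if finite (K \<omega>) then \<Sum>k. if k \<in> K \<omega> then g k \<omega> else 0 else 0)" for \<omega>
    using sums_unique[OF sums_If_finite_set[of "K \<omega>" "\<lambda>k. g k \<omega>"]] by simp
  hence [measurable]: "(\<lambda>\<omega>. sum (\<lambda>k. g k \<omega>) (K \<omega>)) \<in> borel_measurable M"
    by simp
  have "{k. R k \<omega> \<in> {0..T} \<and> R k \<omega> \<notin> fetches (due \<omega>)} = K \<omega>" for \<omega>
    by (auto simp: K_def S)
  hence "(\<lambda>\<omega>. item_cost c\<^sub>f c\<^sub>a (\<lambda>k. U k \<omega>) (\<lambda>k. R k \<omega>) (fetches (due \<omega>)) T)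
    = (\<lambda>\<omega>. c\<^sub>f * real (card (fetches (due \<omega>) \<inter> {0..T})) + sum (\<lambda>k. g k \<omega>) (K \<omega>))"
    by (simp add: item_cost_def g_def)
  thus ?thesis by simp
qed

text \<open>Moving \<open>t\<close> back to the latest update in \<open>{s \<omega><..t}\<close>
  changes no count, so countably many candidates suffice. Since \<open>\<eta> > 0\<close>, a due
  count is positive, which makes the set finite and nonempty: infinite sets have cardinality
  0.\<close>

lemma borel_measurable_item_cost_push:
  assumes [measurable]: "\<And>k. U k \<in> borel_measurable M" "\<And>k. R k \<in> borel_measurable M"
    and "\<eta> > 0"
  shows "(\<lambda>\<omega>. item_cost c\<^sub>f c\<^sub>a (\<lambda>k. U k \<omega>) (\<lambda>k. R k \<omega>) (push_fetches \<eta> (\<lambda>k. U k \<omega>)) T)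
           \<in> borel_measurable M"
  unfolding push_fetches_def
proof (rule borel_measurable_item_cost)
  fix s :: "'a \<Rightarrow> real" and a assume [measurable]: "s \<in> borel_measurable M"
  have "(\<exists>t. s \<omega> < t \<and> \<eta> \<le> real (card {j. U j \<omega> \<in> {s \<omega><..t}}) \<and> t < a) \<longleftrightarrow>
        (\<exists>k. s \<omega> < U k \<omega> \<and> \<eta> \<le> real (card {j. s \<omega> < U j \<omega> \<and> U j \<omega> \<le> U k \<omega>}) \<and> U k \<omega> < a)" for \<omega>
  proof safe
    fix t assume t: "s \<omega> < t" "\<eta> \<le> real (card {j. U j \<omega> \<in> {s \<omega><..t}})" "t < a"
    let ?F = "{j. U j \<omega> \<in> {s \<omega><..t}}"
    have "card ?F > 0" using t \<open>\<eta> > 0\<close> by linarith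
    hence F: "finite ?F" "?F \<noteq> {}" by (auto simp only: card_gt_0_iff)
    then obtain k where k: "k \<in> ?F" "U k \<omega> = Max ((\<lambda>j. U j \<omega>) ` ?F)"
      using Max_in[of "(\<lambda>j. U j \<omega>) ` ?F"] by fastforce
    have "U j \<omega> \<le> U k \<omega>" if "j \<in> ?F" for j
      using F that unfolding k(2) by (intro Max_ge) auto
    hence "{j. s \<omega> < U j \<omega> \<and> U j \<omega> \<le> U k \<omega>} = ?F" using k(1) by auto
    thus "\<exists>k. s \<omega> < U k \<omega> \<and> \<eta> \<le> real (card {j. s \<omega> < U j \<omega> \<and> U j \<omega> \<le> U k \<omega>}) \<and> U k \<omega> < a"
      using k(1) t by (intro exI[of _ k]) auto
  next
    fix k assume "s \<omega> < U k \<omega>" "\<eta> \<le> real (card {j. s \<omega> < U j \<omega> \<and> U j \<omega> \<le> U k \<omega>})" "U k \<omega> < a"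
    thus "\<exists>t. s \<omega> < t \<and> \<eta> \<le> real (card {j. U j \<omega> \<in> {s \<omega><..t}}) \<and> t < a"
      by (intro exI[of _ "U k \<omega>"]) simp
  qed
  moreover have [measurable]: "(\<lambda>\<omega>. real (card {j. s \<omega> < U j \<omega> \<and> U j \<omega> \<le> U k \<omega>})) \<in> borel_measurable M" for k
    by (intro borel_measurable_real_card) measurable
  have "Measurable.pred M (\<lambda>\<omega>. \<exists>k. s \<omega> < U k \<omega> \<and>
      \<eta> \<le> real (card {j. s \<omega> < U j \<omega> \<and> U j \<omega> \<le> U k \<omega>}) \<and> U k \<omega> < a)"
    by measurable
  ultimately show "Measurable.pred M (\<lambda>\<omega>. \<exists>t. s \<omega> < t \<and> \<eta> \<le> real (card {j. U j \<omega> \<in> {s \<omega><..t}}) \<and> t < a)"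
    by simp
qed measurable

lemma borel_measurable_item_cost_pull:
  assumes [measurable]: "\<And>k. U k \<in> borel_measurable M" "\<And>k. R k \<in> borel_measurable M"
  shows "(\<lambda>\<omega>. item_cost c\<^sub>f c\<^sub>a (\<lambda>k. U k \<omega>) (\<lambda>k. R k \<omega>) (pull_fetches \<tau> (\<lambda>k. R k \<omega>)) T)
           \<in> borel_measurable M"
  unfolding pull_fetches_def
proof (rule borel_measurable_item_cost)
  fix s :: "'a \<Rightarrow> real" and a assume [measurable]: "s \<in> borel_measurable M"
  have "(\<lambda>\<omega>. \<exists>t. s \<omega> < t \<and> (t \<in> range (\<lambda>k. R k \<omega>) \<and> \<tau> < t - s \<omega>) \<and> t < a) =
        (\<lambda>\<omega>. \<exists>k. s \<omega> < R k \<omega> \<and> \<tau> < R k \<omega> - s \<omega> \<and> R k \<omega> < a)"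
    by auto
  thus "Measurable.pred M (\<lambda>\<omega>. \<exists>t. s \<omega> < t \<and> (t \<in> range (\<lambda>k. R k \<omega>) \<and> \<tau> < t - s \<omega>) \<and> t < a)"
    by simp
qed measurable

text \<open>Freezing: the joint law is a product, so Tonelli's theorem lets one variable be held
  fixed while the other is averaged.\<close>

lemma (in prob_space) nn_integral_indep_var:
  assumes ind: "indep_var S X T Y" and f [measurable]: "f \<in> borel_measurable (S \<Otimes>\<^sub>M T)"
  shows "(\<integral>\<^sup>+\<omega>. f (X \<omega>, Y \<omega>) \<partial>M) = (\<integral>\<^sup>+\<omega>. (\<integral>\<^sup>+\<omega>'. f (X \<omega>, Y \<omega>') \<partial>M) \<partial>M)"
proof -
  have [measurable]: "X \<in> measurable M S" "Y \<in> measurable M T"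
    and eq: "distr M S X \<Otimes>\<^sub>M distr M T Y = distr M (S \<Otimes>\<^sub>M T) (\<lambda>\<omega>. (X \<omega>, Y \<omega>))"
    using ind by (simp_all add: indep_var_distribution_eq)
  interpret Y: prob_space "distr M T Y" by (rule prob_space_distr) measurable
  have "(\<integral>\<^sup>+\<omega>. f (X \<omega>, Y \<omega>) \<partial>M) = (\<integral>\<^sup>+z. f z \<partial>distr M (S \<Otimes>\<^sub>M T) (\<lambda>\<omega>. (X \<omega>, Y \<omega>)))"
    by (simp add: nn_integral_distr)
  also have "\<dots> = (\<integral>\<^sup>+x. (\<integral>\<^sup>+y. f (x, y) \<partial>distr M T Y) \<partial>distr M S X)"
    unfolding eq[symmetric] by (rule Y.nn_integral_fst[symmetric]) measurable
  also have "\<dots> = (\<integral>\<^sup>+\<omega>. (\<integral>\<^sup>+y. f (X \<omega>, y) \<partial>distr M T Y) \<partial>M)"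
    by (subst nn_integral_distr) auto
  also have "\<dots> = (\<integral>\<^sup>+\<omega>. (\<integral>\<^sup>+\<omega>'. f (X \<omega>, Y \<omega>') \<partial>M) \<partial>M)"
    by (intro nn_integral_cong) (subst nn_integral_distr; simp)
  finally show ?thesis .
qed

section \<open>The push policy\<close>

lemma sum_periodic_eq:
  fixes e :: "nat \<Rightarrow> real"
  assumes "m \<ge> 1" "(\<Sum>j<m. e j) = 0"
  shows "(\<Sum>j<n. e (j mod m)) = (\<Sum>j<n mod m. e j)"
proof (induction n)
  case (Suc n)
  show ?case
  proof (cases "Suc (n mod m) = m")
    case True
    have "(\<Sum>j<m. e j) = (\<Sum>j<n mod m. e j) + e (n mod m)"
      by (subst True[symmetric]) simp
    with assms Suc True show ?thesis by (simp add: mod_Suc)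
  qed (simp add: Suc mod_Suc)
qed simp

text \<open>Abel summation: the bounded partial sums of \<open>d\<close> are weighted with the
  nonnegative decrements of \<open>P\<close>, which telescope.\<close>

lemma abs_sum_mult_decseq_le:
  fixes d P :: "nat \<Rightarrow> real"
  assumes B: "\<And>n. \<bar>\<Sum>j<n. d j\<bar> \<le> B" and P: "\<And>j. P (Suc j) \<le> P j" "\<And>j. 0 \<le> P j"
  shows "\<bar>\<Sum>j<n. d j * P j\<bar> \<le> B * P 0"
proof -
  have "B \<ge> 0" using B[of 0] by simp
  have eq: "(\<Sum>j<n. d j * P j) =
      (\<Sum>j<n. (\<Sum>i<Suc j. d i) * (P j - P (Suc j))) + (\<Sum>j<n. d j) * P n" for n
    by (induction n) (simp_all add: algebra_simps)
  have "\<bar>\<Sum>j<n. d j * P j\<bar> \<le>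
      (\<Sum>j<n. \<bar>(\<Sum>i<Suc j. d i) * (P j - P (Suc j))\<bar>) + \<bar>(\<Sum>j<n. d j) * P n\<bar>"
    unfolding eq by (rule order_trans[OF abs_triangle_ineq add_right_mono[OF sum_abs]])
  also have "\<dots> \<le> (\<Sum>j<n. B * (P j - P (Suc j))) + B * P n"
  proof (intro add_mono sum_mono)
    show "\<bar>(\<Sum>i<Suc j. d i) * (P j - P (Suc j))\<bar> \<le> B * (P j - P (Suc j))" for j
      unfolding abs_mult using B[of "Suc j"] P(1)[of j] \<open>B \<ge> 0\<close> by (intro mult_mono) auto
    show "\<bar>(\<Sum>j<n. d j) * P n\<bar> \<le> B * P n"
      unfolding abs_mult using B[of n] P(2)[of n] \<open>B \<ge> 0\<close> by (intro mult_mono) auto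
  qed
  also have "(\<Sum>j<n. B * (P j - P (Suc j))) = B * (P 0 - P n)"
    by (simp add: sum_lessThan_telescope' flip: sum_distrib_left)
  finally show ?thesis by (simp add: algebra_simps)
qed

context poisson
begin

lemma reach_nonneg: "0 \<le> reach T k" and reach_le_1: "reach T k \<le> 1"
  by (simp_all add: reach_def)

lemma reach_eq: "T \<ge> 0 \<Longrightarrow> reach T k = erlang_CDF k r T"
  using erlang_distributed_le[OF jump_distributed rate_pos] by (simp add: reach_def)

text \<open>The event says that exactly \<open>i + 1\<close> jumps have occurred by
  \<open>t\<close>. This Poisson weight is a difference of consecutive Erlang distribution functions
  and, up to the factor \<open>r\<close>, again an Erlang density.\<close>

lemma nn_integral_between_jumps:
  assumes "t \<ge> 0"
  shows "(\<integral>\<^sup>+\<omega>. indicator {J i \<omega>..<J (Suc i) \<omega>} t \<partial>M) = ennreal (erlang_density (Suc i) r t / r)"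
proof -
  have "(\<integral>\<^sup>+\<omega>. indicator {J i \<omega>..<J (Suc i) \<omega>} t \<partial>M)
      = (\<integral>\<^sup>+\<omega>. indicator {\<omega>\<in>space M. J i \<omega> \<le> t \<and> t < J (Suc i) \<omega>} \<omega> \<partial>M)"
    by (intro nn_integral_cong) (auto split: split_indicator)
  also have "\<dots> = prob {\<omega>\<in>space M. J i \<omega> \<le> t \<and> t < J (Suc i) \<omega>}"
    by (simp add: emeasure_eq_measure)
  also have "prob {\<omega>\<in>space M. J i \<omega> \<le> t \<and> t < J (Suc i) \<omega>} = reach t i - reach t (Suc i)"
  proof -
    have "AE \<omega> in M. J i \<omega> \<le> J (Suc i) \<omega>"
      using AE_gap_pos[of "Suc i"] by (auto elim!: eventually_mono simp: jump_gap_def)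
    hence "reach t i = prob ({\<omega>\<in>space M. J i \<omega> \<le> t \<and> t < J (Suc i) \<omega>} \<union> {\<omega>\<in>space M. J (Suc i) \<omega> \<le> t})"
      unfolding reach_def by (intro finite_measure_eq_AE) (auto elim!: eventually_mono)
    also have "\<dots> = prob {\<omega>\<in>space M. J i \<omega> \<le> t \<and> t < J (Suc i) \<omega>} + reach t (Suc i)"
      unfolding reach_def by (intro finite_measure_Union) auto
    finally show ?thesis by simp
  qed
  also have "\<dots> = erlang_density (Suc i) r t / r"
    using assms rate_pos
    by (simp add: reach_eq erlang_CDF_def erlang_density_def power_mult_distrib)
  finally show ?thesis .
qed

lemma nn_integral_occupation:
  "(\<integral>\<^sup>+t\<in>{0..T}. (\<integral>\<^sup>+\<omega>. indicator {J i \<omega>..<J (Suc i) \<omega>} t \<partial>M) \<partial>lborel) = ennreal (reach T (Suc i) / r)"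
proof -
  have "(\<integral>\<^sup>+t\<in>{0..T}. (\<integral>\<^sup>+\<omega>. indicator {J i \<omega>..<J (Suc i) \<omega>} t \<partial>M) \<partial>lborel)
      = (\<integral>\<^sup>+t. ennreal (1 / r) * (ennreal (erlang_density (Suc i) r t) * indicator {0..T} t) \<partial>lborel)"
    using rate_pos
    by (intro nn_integral_cong)
       (auto simp: nn_integral_between_jumps divide_inverse mult.commute ennreal_mult split: split_indicator)
  also have "\<dots> = ennreal (1 / r) * (\<integral>\<^sup>+t. ennreal (erlang_density (Suc i) r t) * indicator {0..T} t \<partial>lborel)"
    by (intro nn_integral_cmult) measurable
  also have "(\<integral>\<^sup>+t. ennreal (erlang_density (Suc i) r t) * indicator {0..T} t \<partial>lborel) = ennreal (reach T (Suc i))"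
    by (subst distributed_nn_integral[OF jump_distributed]) (auto simp: ennreal_reach)
  finally show ?thesis
    using rate_pos by (simp add: ennreal_mult'[symmetric])
qed

end

lemma borel_measurable_indicator_interval [measurable (raw)]:
  fixes f g h :: "'w \<Rightarrow> real"
  assumes [measurable]: "f \<in> borel_measurable M" "g \<in> borel_measurable M" "h \<in> borel_measurable M"
  shows "(\<lambda>x. indicator {f x..<g x} (h x) :: ennreal) \<in> borel_measurable M"
    and "(\<lambda>x. indicator {f x<..g x} (h x) :: ennreal) \<in> borel_measurable M"
    and "(\<lambda>x. indicator {f x..g x} (h x) :: ennreal) \<in> borel_measurable M"
proof -
  have "(\<lambda>x. if f x \<le> h x \<and> h x < g x then 1 else 0 :: ennreal) \<in> borel_measurable M"
       "(\<lambda>x. if f x < h x \<and> h x \<le> g x then 1 else 0 :: ennreal) \<in> borel_measurable M"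
       "(\<lambda>x. if f x \<le> h x \<and> h x \<le> g x then 1 else 0 :: ennreal) \<in> borel_measurable M"
    by measurable
  thus "(\<lambda>x. indicator {f x..<g x} (h x) :: ennreal) \<in> borel_measurable M"
    and "(\<lambda>x. indicator {f x<..g x} (h x) :: ennreal) \<in> borel_measurable M"
    and "(\<lambda>x. indicator {f x..g x} (h x) :: ennreal) \<in> borel_measurable M"
    by (simp_all add: indicator_def of_bool_def)
qed

abbreviation paths :: "(nat \<Rightarrow> real) measure" where
  "paths \<equiv> \<Pi>\<^sub>M k\<in>UNIV. borel"

text \<open>Requests sample the age at rate \<open>r\<close>, and the state with \<open>j\<close>
  updates lasts for a mean time \<open>reach T j / l\<close> within the horizon. Its aging cost thus
  has the same coefficient \<open>reach T j\<close> as the fetch at update \<open>j\<close>.\<close>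

lemma (in prob_space) nn_integral_item_cost_push:
  fixes U R :: "nat \<Rightarrow> 'a \<Rightarrow> real"
  assumes U: "poisson M U l" and R: "poisson M R r"
    and ind: "indep_var paths (\<lambda>\<omega> k. U k \<omega>) paths (\<lambda>\<omega> k. R k \<omega>)"
    and m: "m \<ge> 1" and c: "c\<^sub>f \<ge> 0" "c\<^sub>a \<ge> 0"
  shows "(\<integral>\<^sup>+\<omega>. ennreal (item_cost c\<^sub>f c\<^sub>a (\<lambda>k. U k \<omega>) (\<lambda>k. R k \<omega>) (push_fetches (real m) (\<lambda>k. U k \<omega>)) T) \<partial>M)
    = (\<Sum>j. ennreal ((c\<^sub>f * of_bool (m dvd Suc j) + c\<^sub>a * r / l * real (j mod m)) * poisson.reach M U T j))"
proof -
  interpret U: poisson M U l by fact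
  interpret R: poisson M R r by fact
  \<comment> \<open>The cost of a request at time \<open>t\<close> as a series: measurable on all
    paths, and equal to the cost given by the age on good ones.\<close>
  define g where "g u t = (\<Sum>j. ennreal (c\<^sub>a * real (j mod m)) * indicator {u (j - 1)..<u j} t) * indicator {0..T} t"
    for u :: "nat \<Rightarrow> real" and t
  have [measurable]: "(\<lambda>(u, t). g u t) \<in> borel_measurable (paths \<Otimes>\<^sub>M borel)"
    unfolding g_def by measurable
  define h where "h \<omega> = (\<Sum>j. ennreal (c\<^sub>f * of_bool (m dvd Suc j)) * indicator {0..T} (U j \<omega>))" for \<omega>
  have [measurable]: "h \<in> borel_measurable M" unfolding h_def by measurable
  have [measurable]: "(\<lambda>\<omega> k. U k \<omega>) \<in> measurable M paths" "(\<lambda>\<omega> k. R k \<omega>) \<in> measurable M paths"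
    using ind by (auto simp: indep_var_distribution_eq)
  have "AE \<omega> in M. ennreal (item_cost c\<^sub>f c\<^sub>a (\<lambda>k. U k \<omega>) (\<lambda>k. R k \<omega>) (push_fetches (real m) (\<lambda>k. U k \<omega>)) T)
      = h \<omega> + (\<Sum>k. g (\<lambda>k. U k \<omega>) (R k \<omega>))"
    using U.AE_jump_path R.AE_jump_path
  proof eventually_elim
    case (elim \<omega>)
    have "g (\<lambda>k. U k \<omega>) t = ennreal (c\<^sub>a * real (count_jumps (\<lambda>k. U k \<omega>) t mod m)) * indicator {0..T} t" for t
      unfolding g_def by (subst suminf_count_jumps[OF elim(1)]) auto
    hence "ennreal (\<Sum>k | R k \<omega> \<in> {0..T}. c\<^sub>a * real (count_jumps (\<lambda>k. U k \<omega>) (R k \<omega>) mod m))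
        = (\<Sum>k. g (\<lambda>k. U k \<omega>) (R k \<omega>))"
      using c by (subst ennreal_sum_jumps[OF elim(2)]) auto
    moreover have "ennreal (\<Sum>j | U j \<omega> \<in> {0..T}. c\<^sub>f * of_bool (m dvd Suc j)) = h \<omega>"
      unfolding h_def using c by (intro ennreal_sum_jumps[OF elim(1)]) auto
    moreover have "0 \<le> (\<Sum>j | U j \<omega> \<in> {0..T}. c\<^sub>f * of_bool (m dvd Suc j))"
      "0 \<le> (\<Sum>k | R k \<omega> \<in> {0..T}. c\<^sub>a * real (count_jumps (\<lambda>k. U k \<omega>) (R k \<omega>) mod m))"
      using c by (intro sum_nonneg; simp)+
    ultimately show ?case
      unfolding item_cost_push[OF elim(1) m elim(2)] by (simp only: ennreal_plus)
  qed
  hence "(\<integral>\<^sup>+\<omega>. ennreal (item_cost c\<^sub>f c\<^sub>a (\<lambda>k. U k \<omega>) (\<lambda>k. R k \<omega>) (push_fetches (real m) (\<lambda>k. U k \<omega>)) T) \<partial>M)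
      = (\<integral>\<^sup>+\<omega>. h \<omega> + (\<Sum>k. g (\<lambda>k. U k \<omega>) (R k \<omega>)) \<partial>M)"
    by (rule nn_integral_cong_AE)
  also have "\<dots> = (\<integral>\<^sup>+\<omega>. h \<omega> \<partial>M) + (\<integral>\<^sup>+\<omega>. (\<Sum>k. g (\<lambda>k. U k \<omega>) (R k \<omega>)) \<partial>M)"
    by (rule nn_integral_add) measurable
  also have "(\<integral>\<^sup>+\<omega>. h \<omega> \<partial>M) = (\<Sum>j. ennreal (c\<^sub>f * of_bool (m dvd Suc j) * U.reach T j))"
    unfolding h_def using c
    by (subst nn_integral_suminf)
       (auto simp: nn_integral_cmult ennreal_mult U.reach_nonneg U.ennreal_reach intro!: suminf_cong)
  also have "(\<integral>\<^sup>+\<omega>. (\<Sum>k. g (\<lambda>k. U k \<omega>) (R k \<omega>)) \<partial>M)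
      = (\<integral>\<^sup>+\<omega>. (\<integral>\<^sup>+\<omega>'. (\<Sum>k. g (\<lambda>k. U k \<omega>) (R k \<omega>')) \<partial>M) \<partial>M)"
    by (rule nn_integral_indep_var[OF ind, where f = "\<lambda>(u, v). \<Sum>k. g u (v k)", unfolded prod.case]) measurable
  also have "\<dots> = (\<integral>\<^sup>+\<omega>. ennreal r * (\<integral>\<^sup>+t\<in>{0..}. g (\<lambda>k. U k \<omega>) t \<partial>lborel) \<partial>M)"
    by (intro nn_integral_cong R.nn_integral_jumps) measurable
  also have "\<dots> = ennreal r * (\<integral>\<^sup>+\<omega>. (\<integral>\<^sup>+t\<in>{0..}. g (\<lambda>k. U k \<omega>) t \<partial>lborel) \<partial>M)"
    by (intro nn_integral_cmult) measurable
  also have "(\<integral>\<^sup>+\<omega>. (\<integral>\<^sup>+t\<in>{0..}. g (\<lambda>k. U k \<omega>) t \<partial>lborel) \<partial>M)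
      = (\<integral>\<^sup>+\<omega>. (\<integral>\<^sup>+t. (\<Sum>j. ennreal (c\<^sub>a * real (j mod m)) * indicator {U (j - 1) \<omega>..<U j \<omega>} t * indicator {0..T} t) \<partial>lborel) \<partial>M)"
    by (intro nn_integral_cong) (auto simp: g_def split: split_indicator)
  also have "\<dots> = (\<Sum>j. \<integral>\<^sup>+\<omega>. (\<integral>\<^sup>+t. ennreal (c\<^sub>a * real (j mod m)) * indicator {U (j - 1) \<omega>..<U j \<omega>} t * indicator {0..T} t \<partial>lborel) \<partial>M)"
    by (subst nn_integral_suminf, measurable, subst nn_integral_suminf, measurable)
  also have "\<dots> = (\<Sum>j. ennreal (c\<^sub>a / l * real (j mod m) * U.reach T j))"
  proof (intro suminf_cong)
    fix j
    interpret L: pair_sigma_finite lborel M ..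
    show "(\<integral>\<^sup>+\<omega>. (\<integral>\<^sup>+t. ennreal (c\<^sub>a * real (j mod m)) * indicator {U (j - 1) \<omega>..<U j \<omega>} t * indicator {0..T} t \<partial>lborel) \<partial>M)
       = ennreal (c\<^sub>a / l * real (j mod m) * U.reach T j)"
    proof (cases j)
      case (Suc i)
      have "(\<integral>\<^sup>+\<omega>. (\<integral>\<^sup>+t. ennreal (c\<^sub>a * real (j mod m)) * indicator {U (j - 1) \<omega>..<U j \<omega>} t * indicator {0..T} t \<partial>lborel) \<partial>M)
          = (\<integral>\<^sup>+t. (\<integral>\<^sup>+\<omega>. ennreal (c\<^sub>a * real (j mod m)) * indicator {U i \<omega>..<U (Suc i) \<omega>} t * indicator {0..T} t \<partial>M) \<partial>lborel)"
        unfolding Suc by (subst L.Fubini'[symmetric]) (simp_all, measurable)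
      also have "\<dots> = (\<integral>\<^sup>+t. ennreal (c\<^sub>a * real (j mod m)) * ((\<integral>\<^sup>+\<omega>. indicator {U i \<omega>..<U (Suc i) \<omega>} t \<partial>M) * indicator {0..T} t) \<partial>lborel)"
        by (intro nn_integral_cong) (simp add: nn_integral_cmult nn_integral_multc mult.assoc)
      also have "\<dots> = ennreal (c\<^sub>a * real (j mod m)) * ennreal (U.reach T j / l)"
        by (subst nn_integral_cmult) (measurable, simp add: U.nn_integral_occupation Suc)
      also have "\<dots> = ennreal (c\<^sub>a / l * real (j mod m) * U.reach T j)"
        using c U.rate_pos by (subst ennreal_mult[symmetric]) (auto simp: U.reach_nonneg)
      finally show ?thesis .
    qed simp
  qed
  also have "ennreal r * \<dots> = (\<Sum>j. ennreal (c\<^sub>a * r / l * real (j mod m) * U.reach T j))"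
    using c R.rate_pos U.rate_pos
    by (subst ennreal_suminf_cmult[symmetric], intro suminf_cong, subst ennreal_mult[symmetric])
       (auto simp: U.reach_nonneg field_simps)
  also have "(\<Sum>j. ennreal (c\<^sub>f * of_bool (m dvd Suc j) * U.reach T j)) + \<dots>
      = (\<Sum>j. ennreal ((c\<^sub>f * of_bool (m dvd Suc j) + c\<^sub>a * r / l * real (j mod m)) * U.reach T j))"
    using c R.rate_pos U.rate_pos
    by (subst suminf_add) (auto simp: U.reach_nonneg ennreal_plus[symmetric] algebra_simps simp del: ennreal_plus intro!: suminf_cong)
  finally show ?thesis .
qed

lemma item_cost_nonneg: "0 \<le> c\<^sub>f \<Longrightarrow> 0 \<le> c\<^sub>a \<Longrightarrow> 0 \<le> item_cost c\<^sub>f c\<^sub>a U R S T"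
  unfolding item_cost_def by (intro add_nonneg_nonneg sum_nonneg mult_nonneg_nonneg) auto

lemma (in prob_space) expectation_item_cost_push:
  fixes U R :: "nat \<Rightarrow> 'a \<Rightarrow> real"
  assumes U: "poisson M U l" and R: "poisson M R r"
    and ind: "indep_var paths (\<lambda>\<omega> k. U k \<omega>) paths (\<lambda>\<omega> k. R k \<omega>)"
    and m: "m \<ge> 1" and c: "c\<^sub>f \<ge> 0" "c\<^sub>a \<ge> 0"
  defines "cost \<equiv> \<lambda>T \<omega>. item_cost c\<^sub>f c\<^sub>a (\<lambda>k. U k \<omega>) (\<lambda>k. R k \<omega>) (push_fetches (real m) (\<lambda>k. U k \<omega>)) T"
  shows "\<exists>B. \<forall>T\<ge>0. integrable M (cost T) \<and>
           \<bar>expectation (cost T) - (c\<^sub>f * l / real m + c\<^sub>a * r * (real m - 1) / 2) * T\<bar> \<le> B"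
proof -
  interpret U: poisson M U l by fact
  interpret R: poisson M R r by fact
  \<comment> \<open>\<open>w\<close> is the weight over one period, where \<open>m dvd Suc j\<close>
    means residue \<open>m - 1\<close>; \<open>a\<close> is its mean, and \<open>B\<close> bounds
    every partial sum of \<open>w - a\<close> within a period.\<close>
  define w where "w j = c\<^sub>f * of_bool (Suc j = m) + c\<^sub>a * r / l * real j" for j
  define a where "a = c\<^sub>f / real m + c\<^sub>a * r / l * ((real m - 1) / 2)"
  define B where "B = (\<Sum>j<m. \<bar>w j - a\<bar>)"
  have w: "c\<^sub>f * of_bool (m dvd Suc j) + c\<^sub>a * r / l * real (j mod m) = w (j mod m)" for j
    by (auto simp: w_def dvd_eq_mod_eq_0 mod_Suc)
  have w_nonneg: "0 \<le> w j" for j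
    using c U.rate_pos R.rate_pos by (simp add: w_def)
  have "(\<Sum>j<m. w j - a) = 0"
  proof -
    have "(\<Sum>j<m. of_bool (Suc j = m)) = (1::real)"
      using m by (cases m) (auto simp: of_bool_def)
    moreover have "(\<Sum>j<m. real j) = real m * (real m - 1) / 2"
      by (induction m) (auto simp: field_simps)
    ultimately have "(\<Sum>j<m. w j) = c\<^sub>f + c\<^sub>a * r / l * (real m * (real m - 1) / 2)"
      by (simp only: w_def sum.distrib flip: sum_distrib_left)
    also have "\<dots> = real m * a"
      using m unfolding a_def by (simp add: distrib_left)
    finally show ?thesis by (simp add: sum_subtractf)
  qed
  hence "(\<Sum>j<n. w (j mod m) - a) = (\<Sum>j<n mod m. w j - a)" for n
    using m by (rule sum_periodic_eq[rotated])
  moreover have "\<bar>\<Sum>j<n mod m. w j - a\<bar> \<le> B" for n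
  proof -
    have "\<bar>\<Sum>j<n mod m. w j - a\<bar> \<le> (\<Sum>j<n mod m. \<bar>w j - a\<bar>)" by (rule sum_abs)
    also have "\<dots> \<le> B" using m unfolding B_def by (intro sum_mono2) (auto intro: less_trans simp: less_le_trans)
    finally show ?thesis .
  qed
  ultimately have B: "\<bar>\<Sum>j<n. w (j mod m) - a\<bar> \<le> B" for n by simp
  have "integrable M (cost T) \<and> \<bar>expectation (cost T) - a * l * T\<bar> \<le> B" if T: "T \<ge> 0" for T
  proof -
    define s where "s = (\<lambda>j. w (j mod m) * U.reach T j)"
    have s_nonneg: "0 \<le> s j" for j using w_nonneg U.reach_nonneg by (simp add: s_def)
    have "summable s"
    proof (rule summable_comparison_test')
      show "summable (\<lambda>j. (\<Sum>i<m. w i) * U.reach T j)"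
        using U.sums_reach[OF T] by (intro summable_mult) (simp add: sums_iff)
      show "norm (s j) \<le> (\<Sum>i<m. w i) * U.reach T j" for j
      proof -
        have "w (j mod m) \<le> (\<Sum>i<m. w i)"
          using m w_nonneg by (intro member_le_sum) auto
        thus ?thesis using w_nonneg by (simp add: s_def abs_mult U.reach_nonneg mult_right_mono)
      qed
    qed
    hence nn: "(\<integral>\<^sup>+\<omega>. ennreal (cost T \<omega>) \<partial>M) = ennreal (suminf s)"
      unfolding cost_def nn_integral_item_cost_push[OF U R ind m c] w s_def[symmetric]
      using suminf_ennreal2[OF s_nonneg] by (simp add: s_def)
    have meas: "cost T \<in> borel_measurable M"
      unfolding cost_def using m by (intro borel_measurable_item_cost_push) auto
    have pos: "cost T \<omega> \<ge> 0" for \<omega> unfolding cost_def by (intro item_cost_nonneg c)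
    have int: "integrable M (cost T)"
      using meas pos nn by (intro integrableI_nonneg) auto
    have E: "expectation (cost T) = suminf s"
      using meas pos nn suminf_nonneg[OF \<open>summable s\<close> s_nonneg]
      by (subst integral_eq_nn_integral) auto
    have "(\<lambda>n. (\<Sum>j<n. s j) - a * (\<Sum>j<n. U.reach T j)) \<longlonglongrightarrow> suminf s - a * (l * T)"
      using U.sums_reach[OF T] summable_LIMSEQ[OF \<open>summable s\<close>]
      by (intro tendsto_intros) (auto simp: sums_def)
    hence "(\<lambda>n. \<bar>(\<Sum>j<n. s j) - a * (\<Sum>j<n. U.reach T j)\<bar>) \<longlonglongrightarrow> \<bar>suminf s - a * (l * T)\<bar>"
      by (rule tendsto_rabs)
    moreover have "\<bar>(\<Sum>j<n. s j) - a * (\<Sum>j<n. U.reach T j)\<bar> \<le> B" for n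
    proof -
      have "(\<Sum>j<n. s j) - a * (\<Sum>j<n. U.reach T j) = (\<Sum>j<n. (w (j mod m) - a) * U.reach T j)"
        by (simp add: s_def sum_distrib_left left_diff_distrib sum_subtractf)
      \<comment> \<open>Since \<open>reach T 0 \<le> 1\<close>, the resulting bound is uniform in
        \<open>T\<close>.\<close>
      also have "\<bar>\<dots>\<bar> \<le> B * U.reach T 0"
        by (rule abs_sum_mult_decseq_le) (rule B U.reach_Suc_le U.reach_nonneg)+
      also have "\<dots> \<le> B" using B[of 0] U.reach_le_1[of T 0] by (intro mult_left_le) auto
      finally show ?thesis .
    qed
    ultimately have "\<bar>suminf s - a * (l * T)\<bar> \<le> B"
      by (intro LIMSEQ_le_const2) auto
    thus ?thesis using int E by (simp add: mult.assoc)
  qed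
  moreover have "a * l = c\<^sub>f * l / real m + c\<^sub>a * r * (real m - 1) / 2"
    using U.rate_pos by (simp add: a_def field_simps)
  ultimately show ?thesis by (intro exI[of _ B]) simp
qed

section \<open>The pull policy\<close>

text \<open>The time since the last fetch just after \<open>k\<close> requests, as a function of the
  gaps \<open>x\<close> alone. The next state needs only the present one and a fresh gap, which is
  the Markov property.\<close>

primrec clock :: "real \<Rightarrow> (nat \<Rightarrow> real) \<Rightarrow> nat \<Rightarrow> real" where
  "clock \<tau> x 0 = 0"
| "clock \<tau> x (Suc k) = (if clock \<tau> x k + x k > \<tau> then 0 else clock \<tau> x k + x k)"

lemma clock_cong: "(\<And>i. i < k \<Longrightarrow> x i = y i) \<Longrightarrow> clock \<tau> x k = clock \<tau> y k"
  by (induction k) auto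

lemma clock_bounds:
  assumes "\<tau> \<ge> 0" "\<And>i. x i \<ge> 0" shows "0 \<le> clock \<tau> x k \<and> clock \<tau> x k \<le> \<tau>"
  using assms by (induction k) auto

lemma borel_measurable_clock:
  assumes "\<And>i. i < k \<Longrightarrow> (\<lambda>\<omega>. x \<omega> i) \<in> borel_measurable M"
  shows "(\<lambda>\<omega>. clock \<tau> (x \<omega>) k) \<in> borel_measurable M"
  using assms
proof (induction k)
  case (Suc k)
  hence [measurable]: "(\<lambda>\<omega>. clock \<tau> (x \<omega>) k) \<in> borel_measurable M" "(\<lambda>\<omega>. x \<omega> k) \<in> borel_measurable M"
    by auto
  show ?case by simp
qed simp

lemma jump_minus_last_fetch:
  "J k \<omega> - last_fetch \<tau> (\<lambda>k. J k \<omega>) k = clock \<tau> (\<lambda>i. jump_gap J i \<omega>) k + jump_gap J k \<omega>"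
proof (induction k)
  case (Suc k)
  have "J k \<omega> - last_fetch \<tau> (\<lambda>k. J k \<omega>) (Suc k) = clock \<tau> (\<lambda>i. jump_gap J i \<omega>) (Suc k)"
    using Suc by (simp add: last_fetch_Suc is_fetch_def)
  thus ?case by (simp add: jump_gap_def del: clock.simps)
qed (simp add: jump_gap_def)

lemma is_fetch_iff_clock:
  "is_fetch \<tau> (\<lambda>k. J k \<omega>) k \<longleftrightarrow> clock \<tau> (\<lambda>i. jump_gap J i \<omega>) k + jump_gap J k \<omega> > \<tau>"
  by (simp add: is_fetch_def jump_minus_last_fetch)

lemma jump_minus_last_fetch_Suc:
  "J k \<omega> - last_fetch \<tau> (\<lambda>k. J k \<omega>) (Suc k) = clock \<tau> (\<lambda>i. jump_gap J i \<omega>) (Suc k)"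
  using jump_minus_last_fetch[of J k \<omega> \<tau>] is_fetch_iff_clock[of \<tau> J \<omega> k]
  by (simp add: last_fetch_Suc)

text \<open>
  \<open>potential\<close> is the relative value function, at time \<open>a\<close> since the last fetch, of the control
  problem with request rate \<open>r\<close> and cost \<open>K * a\<close> for a request that is not a fetch.
  \<open>balanced_fetch_cost\<close> is the fetch cost for which the timeout \<open>\<tau>\<close> is optimal;
  the average cost is then \<open>r * K * \<tau>\<close>.
\<close>

definition potential :: "real \<Rightarrow> real \<Rightarrow> real \<Rightarrow> real \<Rightarrow> real" where
  "potential r K \<tau> a = r * K * (\<tau> * a - a\<^sup>2 / 2)"

definition balanced_fetch_cost :: "real \<Rightarrow> real \<Rightarrow> real \<Rightarrow> real" where
  "balanced_fetch_cost r K \<tau> = K * (\<tau> + r * \<tau>\<^sup>2 / 2)"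

text \<open>Immediate cost plus potential afterwards, for a request at time \<open>b\<close> since
  the last fetch; after a fetch the potential is 0. The two branches agree at
  \<open>b = \<tau>\<close>.\<close>

definition request_cost :: "real \<Rightarrow> real \<Rightarrow> real \<Rightarrow> real \<Rightarrow> real" where
  "request_cost r K \<tau> b = (if b > \<tau> then balanced_fetch_cost r K \<tau> else K * b + potential r K \<tau> b)"

lemma potential_mono:
  assumes "r \<ge> 0" "K \<ge> 0" "0 \<le> a" "a \<le> b" "b \<le> \<tau>"
  shows "potential r K \<tau> a \<le> potential r K \<tau> b"
proof -
  have "0 \<le> (b - a) * (\<tau> - (a + b) / 2)" using assms by (intro mult_nonneg_nonneg) auto
  also have "\<dots> = (\<tau> * b - b\<^sup>2 / 2) - (\<tau> * a - a\<^sup>2 / 2)" by (simp add: field_simps power2_eq_square)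
  finally show ?thesis using assms by (auto simp: potential_def intro!: mult_left_mono)
qed

text \<open>On \<open>[0, \<tau>]\<close> the parabola rises to its apex at \<tau>, where aging cost
  plus potential equals the balanced fetch cost.\<close>

lemma potential_bounds:
  assumes "r \<ge> 0" "K \<ge> 0" "0 \<le> a" "a \<le> \<tau>"
  shows "0 \<le> potential r K \<tau> a" "K * a + potential r K \<tau> a \<le> balanced_fetch_cost r K \<tau>"
proof -
  show "0 \<le> potential r K \<tau> a"
    using potential_mono[of r K 0 a \<tau>] assms by (simp add: potential_def)
  have "K * a \<le> K * \<tau>" using assms by (intro mult_left_mono)
  moreover have "balanced_fetch_cost r K \<tau> = K * \<tau> + potential r K \<tau> \<tau>"
    by (simp add: balanced_fetch_cost_def potential_def power2_eq_square algebra_simps)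
  ultimately show "K * a + potential r K \<tau> a \<le> balanced_fetch_cost r K \<tau>"
    using potential_mono[of r K a \<tau> \<tau>] assms by simp
qed

lemma borel_measurable_request_cost [measurable]: "request_cost r K \<tau> \<in> borel_measurable borel"
  unfolding request_cost_def[abs_def] potential_def by measurable

lemma borel_measurable_potential [measurable]: "potential r K \<tau> \<in> borel_measurable borel"
  unfolding potential_def[abs_def] by measurable

lemma request_cost_bounds:
  assumes "r \<ge> 0" "K \<ge> 0" "0 \<le> b" "0 \<le> \<tau>"
  shows "0 \<le> request_cost r K \<tau> b" "request_cost r K \<tau> b \<le> balanced_fetch_cost r K \<tau>"
  using potential_bounds[of r K b \<tau>] assms
  by (auto simp: request_cost_def balanced_fetch_cost_def)

context poisson
begin

text \<open>The Bellman equation of the chain, with average cost \<open>K * \<tau>\<close> per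
  request. \<open>F\<close> is an antiderivative of the integrand on the range without a fetch; its
  value at \<open>\<tau> - a\<close> cancels the contribution of the fetches, and
  \<open>- F 0\<close> is the right-hand side.\<close>

lemma nn_integral_request_cost:
  assumes K: "K \<ge> 0" and a: "0 \<le> a" "a \<le> \<tau>"
  shows "(\<integral>\<^sup>+\<omega>. ennreal (request_cost r K \<tau> (a + jump_gap J k \<omega>)) \<partial>M) = ennreal (potential r K \<tau> a + K * \<tau>)"
proof -
  let ?C = "balanced_fetch_cost r K \<tau>"
  define F where "F x = - exp (- r * x) * (potential r K \<tau> (a + x) + K * \<tau>)" for x
  define f where "f x = r * exp (- r * x) * (K * (a + x) + potential r K \<tau> (a + x))" for x
  have C: "?C \<ge> 0" using K a rate_pos by (simp add: balanced_fetch_cost_def)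
  have deriv: "(F has_real_derivative f x) (at x)" for x
  proof -
    have "((\<lambda>x. potential r K \<tau> (a + x)) has_real_derivative r * K * (\<tau> - (a + x))) (at x)"
      unfolding potential_def by (auto intro!: derivative_eq_intros simp: field_simps)
    thus ?thesis
      unfolding F_def f_def by (auto intro!: derivative_eq_intros simp: algebra_simps)
  qed
  have f_nonneg: "0 \<le> f x" if "0 \<le> x" "x \<le> \<tau> - a" for x
    using that K a rate_pos potential_bounds(1)[of r K "a + x" \<tau>] unfolding f_def
    by (intro mult_nonneg_nonneg add_nonneg_nonneg) auto
  \<comment> \<open>Makes \<open>F (\<tau> - a) - F 0\<close> nonnegative; \<open>ennreal\<close>
    would send a negative value to 0.\<close>
  have F_le: "F 0 \<le> F (\<tau> - a)"
  proof (rule DERIV_nonneg_imp_nondecreasing[of 0 "\<tau> - a" F])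
    show "0 \<le> \<tau> - a" using a by simp
    show "\<exists>y. (F has_real_derivative y) (at x) \<and> 0 \<le> y" if "0 \<le> x" "x \<le> \<tau> - a" for x
      using deriv f_nonneg[OF that] by blast
  qed
  have "(\<integral>\<^sup>+\<omega>. ennreal (request_cost r K \<tau> (a + jump_gap J k \<omega>)) \<partial>M)
      = (\<integral>\<^sup>+x. ennreal (exponential_density r x) * ennreal (request_cost r K \<tau> (a + x)) \<partial>lborel)"
    by (subst distributed_nn_integral[OF gap_distributed]) auto
  also have "\<dots> = (\<integral>\<^sup>+x. ennreal (f x) * indicator {0..\<tau> - a} x +
      ennreal ?C * (ennreal (exponential_density r x) * indicator {\<tau> - a<..} x) \<partial>lborel)"
  proof (intro nn_integral_cong)
    fix x
    show "ennreal (exponential_density r x) * ennreal (request_cost r K \<tau> (a + x))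
        = ennreal (f x) * indicator {0..\<tau> - a} x +
            ennreal ?C * (ennreal (exponential_density r x) * indicator {\<tau> - a<..} x)"
    proof (cases "x \<le> \<tau> - a")
      case True
      thus ?thesis using rate_pos
        by (auto simp: exponential_density_def f_def request_cost_def ennreal_mult'[symmetric]
            mult.commute split: split_indicator)
    next
      case False
      thus ?thesis by (auto simp: request_cost_def mult.commute)
    qed
  qed
  also have "\<dots> = (\<integral>\<^sup>+x. ennreal (f x) * indicator {0..\<tau> - a} x \<partial>lborel) +
      (\<integral>\<^sup>+x. ennreal ?C * (ennreal (exponential_density r x) * indicator {\<tau> - a<..} x) \<partial>lborel)"
    by (intro nn_integral_add) (auto simp: f_def[abs_def])
  also have "(\<integral>\<^sup>+x. ennreal (f x) * indicator {0..\<tau> - a} x \<partial>lborel) = ennreal (F (\<tau> - a) - F 0)"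
  proof (rule nn_integral_FTC_Icc)
    show "f \<in> borel_measurable borel"
      unfolding f_def[abs_def] by measurable
  qed (use a deriv f_nonneg in auto)
  also have "(\<integral>\<^sup>+x. ennreal ?C * (ennreal (exponential_density r x) * indicator {\<tau> - a<..} x) \<partial>lborel)
      = ennreal ?C * (\<integral>\<^sup>+x. ennreal (exponential_density r x) * indicator {\<tau> - a<..} x \<partial>lborel)"
    by (intro nn_integral_cmult) measurable
  also have "(\<integral>\<^sup>+x. ennreal (exponential_density r x) * indicator {\<tau> - a<..} x \<partial>lborel)
      = (\<integral>\<^sup>+\<omega>. indicator {\<tau> - a<..} (jump_gap J k \<omega>) \<partial>M)"
    by (subst distributed_nn_integral[OF gap_distributed]) auto
  also have "\<dots> = (\<integral>\<^sup>+\<omega>. indicator {\<omega> \<in> space M. \<tau> - a < jump_gap J k \<omega>} \<omega> \<partial>M)"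
    by (intro nn_integral_cong) (auto split: split_indicator)
  also have "\<dots> = ennreal (exp (- (\<tau> - a) * r))"
    using exponential_distributedD_gt[OF gap_distributed _ rate_pos, of "\<tau> - a" k] a
    by (simp add: emeasure_eq_measure)
  also have "ennreal (F (\<tau> - a) - F 0) + ennreal ?C * ennreal (exp (- (\<tau> - a) * r))
      = ennreal (potential r K \<tau> a + K * \<tau>)"
  proof -
    have C': "potential r K \<tau> \<tau> + K * \<tau> = ?C"
      by (simp add: balanced_fetch_cost_def potential_def power2_eq_square algebra_simps)
    have "F (\<tau> - a) = - exp (- (\<tau> - a) * r) * ?C"
      unfolding F_def C'[symmetric] by (simp add: algebra_simps)
    hence eq: "F (\<tau> - a) - F 0 = potential r K \<tau> a + K * \<tau> - ?C * exp (- (\<tau> - a) * r)"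
      by (simp add: F_def)
    have "?C * exp (- (\<tau> - a) * r) \<le> potential r K \<tau> a + K * \<tau>"
      using F_le eq by simp
    thus ?thesis unfolding eq using C
      by (subst ennreal_mult[symmetric], simp, simp, subst ennreal_plus[symmetric]) auto
  qed
  finally show ?thesis .
qed

text \<open>\<open>A k\<close> and \<open>Q k\<close> are functions of the gaps before
  \<open>k\<close>, hence independent of gap \<open>k\<close>. The event therefore concerns the
  request at which gap \<open>k\<close> begins, not the one at which it ends.\<close>

lemma nn_integral_request_cost_past:
  fixes T :: real
  assumes K: "K \<ge> 0" and \<tau>: "\<tau> \<ge> 0"
  defines "A \<equiv> \<lambda>k \<omega>. clock \<tau> (\<lambda>i. jump_gap J i \<omega>) k"
    and "Q \<equiv> \<lambda>k \<omega>. indicator {..T} (\<Sum>i<k. jump_gap J i \<omega>) :: ennreal"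
  shows "(\<integral>\<^sup>+\<omega>. ennreal (request_cost r K \<tau> (A k \<omega> + jump_gap J k \<omega>)) * Q k \<omega> \<partial>M)
       = (\<integral>\<^sup>+\<omega>. ennreal (potential r K \<tau> (A k \<omega>) + K * \<tau>) * Q k \<omega> \<partial>M)"
proof -
  let ?P = "\<Pi>\<^sub>M i\<in>{..<k}. (borel :: real measure)" and ?N = "\<Pi>\<^sub>M i\<in>{k}. (borel :: real measure)"
  let ?past = "\<lambda>\<omega>. restrict (\<lambda>i. jump_gap J i \<omega>) {..<k}" and ?now = "\<lambda>\<omega>. restrict (\<lambda>i. jump_gap J i \<omega>) {k}"
  have ind: "indep_var ?P ?past ?N ?now"
    by (rule indep_var_restrict[OF gaps_indep]) auto
  define f where "f = (\<lambda>(x, y). ennreal (request_cost r K \<tau> (clock \<tau> x k + y k)) * indicator {..T} (\<Sum>i<k. x i :: real))"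
  have [measurable]: "(\<lambda>x. clock \<tau> x k) \<in> borel_measurable ?P"
    by (intro borel_measurable_clock) simp
  have f: "f \<in> borel_measurable (?P \<Otimes>\<^sub>M ?N)" unfolding f_def by measurable
  have clock: "clock \<tau> (?past \<omega>) k = A k \<omega>" for \<omega>
    unfolding A_def by (rule clock_cong) simp
  have "(\<integral>\<^sup>+\<omega>. ennreal (request_cost r K \<tau> (A k \<omega> + jump_gap J k \<omega>)) * Q k \<omega> \<partial>M)
      = (\<integral>\<^sup>+\<omega>. f (?past \<omega>, ?now \<omega>) \<partial>M)"
    by (simp add: f_def clock Q_def)
  also have "\<dots> = (\<integral>\<^sup>+\<omega>. (\<integral>\<^sup>+\<omega>'. f (?past \<omega>, ?now \<omega>') \<partial>M) \<partial>M)"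
    by (rule nn_integral_indep_var[OF ind f])
  also have "\<dots> = (\<integral>\<^sup>+\<omega>. (\<integral>\<^sup>+\<omega>'. ennreal (request_cost r K \<tau> (A k \<omega> + jump_gap J k \<omega>')) \<partial>M) * Q k \<omega> \<partial>M)"
    by (simp add: f_def clock Q_def nn_integral_multc)
  also have "\<dots> = (\<integral>\<^sup>+\<omega>. ennreal (potential r K \<tau> (A k \<omega>) + K * \<tau>) * Q k \<omega> \<partial>M)"
  proof (rule nn_integral_cong_AE)
    have "AE \<omega> in M. \<forall>k. jump_gap J k \<omega> > 0"
      using AE_gap_pos by (simp add: AE_all_countable)
    thus "AE \<omega> in M. (\<integral>\<^sup>+\<omega>'. ennreal (request_cost r K \<tau> (A k \<omega> + jump_gap J k \<omega>')) \<partial>M) * Q k \<omega>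
        = ennreal (potential r K \<tau> (A k \<omega>) + K * \<tau>) * Q k \<omega>"
    proof eventually_elim
      case (elim \<omega>)
      have "0 \<le> A k \<omega> \<and> A k \<omega> \<le> \<tau>"
        unfolding A_def using elim \<tau> by (intro clock_bounds) (auto intro: less_imp_le)
      thus ?case by (simp add: nn_integral_request_cost K)
    qed
  qed
  finally show ?thesis .
qed

text \<open>In the bound, one \<open>C\<close> pays for the request interval that straddles
  \<open>T\<close>, the other for the potential left over, and \<open>K * \<tau>\<close> for the
  interval that starts at time 0.\<close>

lemma sums_pull_cost:
  fixes T :: real
  assumes K: "K \<ge> 0" and \<tau>: "\<tau> \<ge> 0" and T: "T \<ge> 0"
  defines "C \<equiv> balanced_fetch_cost r K \<tau>"
    and "A \<equiv> \<lambda>k \<omega>. clock \<tau> (\<lambda>i. jump_gap J i \<omega>) k"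
  defines "Z \<equiv> \<lambda>k \<omega>. C * of_bool (A k \<omega> + jump_gap J k \<omega> > \<tau>) + K * A (Suc k) \<omega>"
  shows "\<exists>e s. (\<forall>k. 0 \<le> e k \<and> (\<integral>\<^sup>+\<omega>. ennreal (Z k \<omega>) * indicator {..T} (J k \<omega>) \<partial>M) = ennreal (e k)) \<and>
      e sums s \<and> \<bar>s - K * \<tau> * r * T\<bar> \<le> 2 * C + K * \<tau>"
proof -
  \<comment> \<open>\<open>Q k\<close> tests the request before gap \<open>k\<close>, as the Bellman
    equation requires, while the cost of request \<open>k\<close> carries
    \<open>Q (Suc k)\<close>.\<close>
  define Q where "Q k \<omega> = (indicator {..T} (\<Sum>i<k. jump_gap J i \<omega>) :: real)" for k \<omega>
  define W where "W k \<omega> = potential r K \<tau> (A k \<omega>)" for k \<omega>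
  define Y where "Y k \<omega> = request_cost r K \<tau> (A k \<omega> + jump_gap J k \<omega>)" for k \<omega>
  have [measurable]: "A k \<in> borel_measurable M" for k
    unfolding A_def by (intro borel_measurable_clock) simp
  have [measurable]: "W k \<in> borel_measurable M" "Y k \<in> borel_measurable M"
      "Z k \<in> borel_measurable M" "Q k \<in> borel_measurable M" for k
    unfolding W_def[abs_def] Y_def[abs_def] Z_def Q_def[abs_def] by measurable
  have Q_Suc: "Q (Suc k) \<omega> = indicator {..T} (J k \<omega>)" for k \<omega>
    by (simp add: Q_def lessThan_Suc_atMost sum_jump_gap)
  have C: "C \<ge> 0" using K \<tau> rate_pos by (simp add: C_def balanced_fetch_cost_def)
  have bounds: "AE \<omega> in M. \<forall>k. 0 \<le> W k \<omega> \<and> W k \<omega> \<le> C \<and> 0 \<le> Y k \<omega> \<and> Y k \<omega> \<le> C \<and>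
      0 \<le> Z k \<omega> \<and> Z k \<omega> \<le> C \<and> Y k \<omega> = Z k \<omega> + W (Suc k) \<omega> \<and> Q (Suc k) \<omega> \<le> Q k \<omega>"
  proof -
    have "AE \<omega> in M. \<forall>k. jump_gap J k \<omega> > 0"
      using AE_gap_pos by (simp add: AE_all_countable)
    thus ?thesis
    proof (eventually_elim, intro allI)
      fix \<omega> k assume gap: "\<forall>k. jump_gap J k \<omega> > 0"
      have A: "0 \<le> A k \<omega> \<and> A k \<omega> \<le> \<tau>" for k
        unfolding A_def using gap \<tau> by (intro clock_bounds) (auto intro: less_imp_le)
      have W: "0 \<le> W k \<omega>" "K * A k \<omega> + W k \<omega> \<le> C" for k
        unfolding W_def C_def using A[of k] K rate_pos by (auto intro!: potential_bounds)
      have "0 \<le> K * A k \<omega>" for k using A[of k] K by simp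
      with W[of k] have W': "W k \<omega> \<le> C" by (smt (verit))
      have Y: "0 \<le> Y k \<omega>" "Y k \<omega> \<le> C"
        unfolding Y_def C_def using A[of k] gap[rule_format, of k] K \<tau> rate_pos
        by (auto intro!: request_cost_bounds)
      have eq: "Y k \<omega> = Z k \<omega> + W (Suc k) \<omega>"
        by (simp add: Y_def Z_def W_def A_def request_cost_def C_def potential_def)
      have "0 \<le> Z k \<omega>" using C \<open>\<And>k. 0 \<le> K * A k \<omega>\<close>[of "Suc k"] by (simp add: Z_def)
      moreover have "Z k \<omega> \<le> C" using eq Y(2) W(1)[of "Suc k"] by simp
      moreover have "Q (Suc k) \<omega> \<le> Q k \<omega>"
        using gap[rule_format, of k] by (auto simp: Q_def split: split_indicator)
      ultimately show "0 \<le> W k \<omega> \<and> W k \<omega> \<le> C \<and> 0 \<le> Y k \<omega> \<and> Y k \<omega> \<le> C \<and>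
          0 \<le> Z k \<omega> \<and> Z k \<omega> \<le> C \<and> Y k \<omega> = Z k \<omega> + W (Suc k) \<omega> \<and> Q (Suc k) \<omega> \<le> Q k \<omega>"
        using W(1)[of k] W' Y eq by simp
    qed
  qed
  have Q01: "0 \<le> Q k \<omega>" "Q k \<omega> \<le> 1" for k \<omega> by (auto simp: Q_def)
  have intQ: "integrable M (Q k)" for k
    by (rule integrable_const_bound[of _ 1]) (auto simp: Q01)
  have int: "integrable M (\<lambda>\<omega>. V \<omega> * Q k \<omega>)"
    if [measurable]: "V \<in> borel_measurable M" and V: "AE \<omega> in M. 0 \<le> V \<omega> \<and> V \<omega> \<le> C" for V k
  proof (rule integrable_const_bound[of _ C])
    show "AE \<omega> in M. norm (V \<omega> * Q k \<omega>) \<le> C"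
      using V
    proof eventually_elim
      case (elim \<omega>)
      have "V \<omega> * Q k \<omega> \<le> C * 1" using elim C Q01 by (intro mult_mono) auto
      thus ?case using elim Q01[of k \<omega>] by simp
    qed
  qed simp
  have AE_W: "AE \<omega> in M. 0 \<le> W k \<omega> \<and> W k \<omega> \<le> C"
    and AE_Y: "AE \<omega> in M. 0 \<le> Y k \<omega> \<and> Y k \<omega> \<le> C"
    and AE_Z: "AE \<omega> in M. 0 \<le> Z k \<omega> \<and> Z k \<omega> \<le> C"
    and AE_eq: "AE \<omega> in M. Y k \<omega> = Z k \<omega> + W (Suc k) \<omega>"
    and AE_Q: "AE \<omega> in M. Q (Suc k) \<omega> \<le> Q k \<omega>" for k
    by (rule eventually_mono[OF bounds], blast)+
  have AE_WQ: "AE \<omega> in M. 0 \<le> W k \<omega> * Q j \<omega>"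
    and AE_YQ: "AE \<omega> in M. 0 \<le> Y k \<omega> * Q j \<omega>"
    and AE_ZQ: "AE \<omega> in M. 0 \<le> Z k \<omega> * Q j \<omega>" for k j
    by (rule eventually_mono[OF bounds], simp add: Q01)+
  have intW: "integrable M (\<lambda>\<omega>. W k \<omega> * Q j \<omega>)" and intY: "integrable M (\<lambda>\<omega>. Y k \<omega> * Q j \<omega>)"
    and intZ: "integrable M (\<lambda>\<omega>. Z k \<omega> * Q j \<omega>)" for k j
    using AE_W AE_Y AE_Z by (auto intro: int)
  define e where "e k = expectation (\<lambda>\<omega>. Z k \<omega> * Q (Suc k) \<omega>)" for k
  define b where "b k = expectation (\<lambda>\<omega>. W k \<omega> * Q k \<omega>)" for k
  define q where "q k = expectation (Q k)" for k
  have step: "expectation (\<lambda>\<omega>. Y k \<omega> * Q k \<omega>) = b k + K * \<tau> * q k" for k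
  proof -
    have "ennreal (expectation (\<lambda>\<omega>. Y k \<omega> * Q k \<omega>)) = (\<integral>\<^sup>+\<omega>. ennreal (Y k \<omega> * Q k \<omega>) \<partial>M)"
      by (rule nn_integral_eq_integral[OF intY AE_YQ, symmetric])
    also have "\<dots> = (\<integral>\<^sup>+\<omega>. ennreal (Y k \<omega>) * indicator {..T} (\<Sum>i<k. jump_gap J i \<omega>) \<partial>M)"
      by (intro nn_integral_cong) (auto simp: Q_def split: split_indicator)
    also have "\<dots> = (\<integral>\<^sup>+\<omega>. ennreal (W k \<omega> + K * \<tau>) * indicator {..T} (\<Sum>i<k. jump_gap J i \<omega>) \<partial>M)"
      unfolding Y_def W_def A_def by (rule nn_integral_request_cost_past[OF K \<tau>])
    also have "\<dots> = (\<integral>\<^sup>+\<omega>. ennreal (W k \<omega> * Q k \<omega> + K * \<tau> * Q k \<omega>) \<partial>M)"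
      by (intro nn_integral_cong) (auto simp: Q_def split: split_indicator)
    also have "\<dots> = ennreal (expectation (\<lambda>\<omega>. W k \<omega> * Q k \<omega> + K * \<tau> * Q k \<omega>))"
    proof (rule nn_integral_eq_integral)
      show "AE \<omega> in M. 0 \<le> W k \<omega> * Q k \<omega> + K * \<tau> * Q k \<omega>"
        using AE_WQ[of k k] by eventually_elim (simp add: Q01 K \<tau>)
    qed (use intW intQ in simp)
    also have "expectation (\<lambda>\<omega>. W k \<omega> * Q k \<omega> + K * \<tau> * Q k \<omega>) = b k + K * \<tau> * q k"
      using intW intQ by (simp add: b_def q_def)
    finally have eq: "ennreal (expectation (\<lambda>\<omega>. Y k \<omega> * Q k \<omega>)) = ennreal (b k + K * \<tau> * q k)" .
    have "0 \<le> expectation (\<lambda>\<omega>. Y k \<omega> * Q k \<omega>)"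
      by (rule integral_nonneg_AE[OF AE_YQ])
    moreover have "0 \<le> b k" unfolding b_def by (rule integral_nonneg_AE[OF AE_WQ])
    moreover have "0 \<le> q k" unfolding q_def by (intro integral_nonneg_AE) (simp add: Q01)
    ultimately show ?thesis using eq K \<tau> by (simp del: ennreal_plus)
  qed
  have next_eq: "expectation (\<lambda>\<omega>. Y k \<omega> * Q (Suc k) \<omega>) = e k + b (Suc k)" for k
  proof -
    have "expectation (\<lambda>\<omega>. Y k \<omega> * Q (Suc k) \<omega>)
        = expectation (\<lambda>\<omega>. Z k \<omega> * Q (Suc k) \<omega> + W (Suc k) \<omega> * Q (Suc k) \<omega>)"
    proof (rule integral_cong_AE)
      show "AE \<omega> in M. Y k \<omega> * Q (Suc k) \<omega> = Z k \<omega> * Q (Suc k) \<omega> + W (Suc k) \<omega> * Q (Suc k) \<omega>"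
        using AE_eq[of k] by eventually_elim (simp add: distrib_right)
    qed measurable
    thus ?thesis using intW intZ by (simp add: e_def b_def)
  qed
  \<comment> \<open>The Bellman equation evaluates \<open>Y k\<close> on \<open>Q k\<close>, the
    cost is counted on \<open>Q (Suc k)\<close>. As \<open>Y k\<close> lies between 0 and
    \<open>C\<close> and \<open>Q\<close> decreases, the discrepancy lies between 0 and
    \<open>C * (q k - q (Suc k))\<close>.\<close>
  have low: "0 \<le> b k + K * \<tau> * q k - (e k + b (Suc k))" for k
    unfolding step[symmetric] next_eq[symmetric] diff_ge_0_iff_ge
  proof (rule integral_mono_AE[OF intY intY])
    show "AE \<omega> in M. Y k \<omega> * Q (Suc k) \<omega> \<le> Y k \<omega> * Q k \<omega>"
      using AE_Y[of k] AE_Q[of k] by eventually_elim (auto intro: mult_left_mono)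
  qed
  have up: "b k + K * \<tau> * q k - (e k + b (Suc k)) \<le> C * (q k - q (Suc k))" for k
  proof -
    have "b k + K * \<tau> * q k - (e k + b (Suc k))
        = expectation (\<lambda>\<omega>. Y k \<omega> * Q k \<omega> - Y k \<omega> * Q (Suc k) \<omega>)"
      unfolding step[symmetric] next_eq[symmetric] using intY by simp
    also have "\<dots> \<le> expectation (\<lambda>\<omega>. C * (Q k \<omega> - Q (Suc k) \<omega>))"
    proof (rule integral_mono_AE)
      show "AE \<omega> in M. Y k \<omega> * Q k \<omega> - Y k \<omega> * Q (Suc k) \<omega> \<le> C * (Q k \<omega> - Q (Suc k) \<omega>)"
        using AE_Y[of k] AE_Q[of k]
      proof eventually_elim
        case (elim \<omega>)
        have "Y k \<omega> * (Q k \<omega> - Q (Suc k) \<omega>) \<le> C * (Q k \<omega> - Q (Suc k) \<omega>)"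
          using elim by (intro mult_right_mono) auto
        thus ?case by (simp add: right_diff_distrib)
      qed
    qed (use intY intQ in auto)
    also have "\<dots> = C * (q k - q (Suc k))" using intQ by (simp add: q_def)
    finally show ?thesis .
  qed
  have "Q 0 = (\<lambda>_. 1)" using T by (simp add: Q_def fun_eq_iff)
  hence q0: "q 0 = 1" by (simp add: q_def prob_space)
  have qSuc: "q (Suc k) = reach T k" for k
  proof -
    have "q (Suc k) = expectation (indicator {\<omega> \<in> space M. J k \<omega> \<le> T})"
      unfolding q_def by (intro Bochner_Integration.integral_cong) (auto simp: Q_Suc split: split_indicator)
    thus ?thesis by (simp add: reach_def Int_def conj_commute)
  qed
  have b0: "b 0 = 0" by (simp add: b_def W_def A_def potential_def)
  have b: "0 \<le> b k \<and> b k \<le> C" for k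
  proof
    show "0 \<le> b k" unfolding b_def by (rule integral_nonneg_AE[OF AE_WQ])
    have "b k \<le> expectation (\<lambda>\<omega>. C)" unfolding b_def
    proof (rule integral_mono_AE[OF intW])
      show "AE \<omega> in M. W k \<omega> * Q k \<omega> \<le> C"
        using AE_W[of k]
      proof eventually_elim
        case (elim \<omega>)
        have "W k \<omega> * Q k \<omega> \<le> C * 1" using elim C Q01 by (intro mult_mono) auto
        thus ?case by simp
      qed
    qed simp
    thus "b k \<le> C" by (simp add: prob_space)
  qed
  have e_nonneg: "0 \<le> e k" for k unfolding e_def by (rule integral_nonneg_AE[OF AE_ZQ])
  \<comment> \<open>Telescopes \<open>low\<close> and \<open>up\<close>; \<open>b n\<close> is the
    potential still outstanding.\<close>
  have partial: "0 \<le> K * \<tau> * (\<Sum>k<n. q k) - b n - (\<Sum>k<n. e k) \<and>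
      K * \<tau> * (\<Sum>k<n. q k) - b n - (\<Sum>k<n. e k) \<le> C * (1 - q n)" for n
  proof (induction n)
    case (Suc n)
    thus ?case using low[of n] up[of n] by (simp add: algebra_simps)
  qed (simp add: b0 q0)
  have qs: "(\<lambda>n. \<Sum>k<n. q k) \<longlonglongrightarrow> 1 + r * T"
    using sums_Suc[of q "r * T"] sums_reach[OF T] qSuc q0 by (simp add: sums_def add.commute)
  have sum_e: "(\<Sum>k<n. e k) \<le> K * \<tau> * (\<Sum>k<n. q k)" for n using partial[of n] b[of n] by linarith
  have "summable e"
  proof (rule bounded_imp_summable[OF e_nonneg])
    fix n
    have "(\<Sum>k<Suc n. q k) \<le> 1 + r * T"
    proof (rule incseq_le[OF _ qs])
      show "incseq (\<lambda>n. \<Sum>k<n. q k)"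
        by (rule incseq_SucI) (simp add: q_def Q01)
    qed
    hence "K * \<tau> * (\<Sum>k<Suc n. q k) \<le> K * \<tau> * (1 + r * T)" using K \<tau> by (intro mult_left_mono) auto
    with sum_e[of "Suc n"] show "(\<Sum>k\<le>n. e k) \<le> K * \<tau> * (1 + r * T)"
      by (simp add: lessThan_Suc_atMost)
  qed
  define s where "s = suminf e"
  have s: "e sums s" unfolding s_def by (rule summable_sums) fact
  have "(\<lambda>n. \<bar>K * \<tau> * (\<Sum>k<n. q k) - (\<Sum>k<n. e k)\<bar>) \<longlonglongrightarrow> \<bar>K * \<tau> * (1 + r * T) - s\<bar>"
    using qs s unfolding sums_def by (intro tendsto_intros)
  moreover have "\<bar>K * \<tau> * (\<Sum>k<n. q k) - (\<Sum>k<n. e k)\<bar> \<le> 2 * C" for n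
  proof -
    have "0 \<le> C * q n" using C by (simp add: q_def Q01)
    with partial[of n] b[of n] show ?thesis by (simp add: right_diff_distrib)
  qed
  ultimately have "\<bar>K * \<tau> * (1 + r * T) - s\<bar> \<le> 2 * C"
    by (intro LIMSEQ_le_const2) auto
  moreover have "K * \<tau> \<ge> 0" using K \<tau> by simp
  ultimately have "\<bar>s - K * \<tau> * r * T\<bar> \<le> 2 * C + K * \<tau>"
    by (simp add: distrib_left mult.assoc)
  moreover have "(\<integral>\<^sup>+\<omega>. ennreal (Z k \<omega>) * indicator {..T} (J k \<omega>) \<partial>M) = ennreal (e k)" for k
  proof -
    have "(\<integral>\<^sup>+\<omega>. ennreal (Z k \<omega>) * indicator {..T} (J k \<omega>) \<partial>M) = (\<integral>\<^sup>+\<omega>. ennreal (Z k \<omega> * Q (Suc k) \<omega>) \<partial>M)"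
      by (intro nn_integral_cong) (auto simp: Q_Suc split: split_indicator)
    also have "\<dots> = ennreal (e k)" unfolding e_def
      by (rule nn_integral_eq_integral[OF intZ AE_ZQ])
    finally show ?thesis .
  qed
  ultimately show ?thesis using s e_nonneg by blast
qed

end

lemma borel_measurable_last_fetch [measurable]:
  "(\<lambda>v. last_fetch \<tau> v k) \<in> borel_measurable paths"
  by (induction k) (simp_all add: last_fetch_Suc is_fetch_def)

text \<open>Averaging over the updates replaces the age by \<open>l\<close> times the time since the
  last fetch, so \<open>K = c\<^sub>a * l\<close>. The premise on \<open>c\<^sub>f\<close> says that
  it is the balanced fetch cost for \<tau>.\<close>

lemma (in prob_space) expectation_item_cost_pull:
  fixes U R :: "nat \<Rightarrow> 'a \<Rightarrow> real"
  assumes U: "poisson M U l" and R: "poisson M R r"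
    and ind: "indep_var paths (\<lambda>\<omega> k. R k \<omega>) paths (\<lambda>\<omega> k. U k \<omega>)"
    and \<tau>: "\<tau> \<ge> 0" and c: "c\<^sub>a \<ge> 0"
    and c\<^sub>f: "c\<^sub>f = c\<^sub>a * l * (\<tau> + r * \<tau>\<^sup>2 / 2)"
  defines "cost \<equiv> \<lambda>T \<omega>. item_cost c\<^sub>f c\<^sub>a (\<lambda>k. U k \<omega>) (\<lambda>k. R k \<omega>) (pull_fetches \<tau> (\<lambda>k. R k \<omega>)) T"
  shows "\<exists>B. \<forall>T\<ge>0. integrable M (cost T) \<and> \<bar>expectation (cost T) - c\<^sub>a * l * \<tau> * r * T\<bar> \<le> B"
proof -
  interpret U: poisson M U l by fact
  interpret R: poisson M R r by fact
  define K where "K = c\<^sub>a * l"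
  have K: "K \<ge> 0" using c U.rate_pos by (simp add: K_def)
  have c\<^sub>f_eq: "c\<^sub>f = balanced_fetch_cost r K \<tau>" by (simp add: c\<^sub>f balanced_fetch_cost_def K_def)
  have c\<^sub>f_nonneg: "c\<^sub>f \<ge> 0"
    using K \<tau> R.rate_pos unfolding c\<^sub>f_eq balanced_fetch_cost_def by (intro mult_nonneg_nonneg) auto
  have "integrable M (cost T) \<and> \<bar>expectation (cost T) - c\<^sub>a * l * \<tau> * r * T\<bar> \<le> 2 * c\<^sub>f + K * \<tau>"
    if T: "T \<ge> 0" for T
  proof -
    \<comment> \<open>The number of updates enters as a separate argument \<open>n\<close>; since
      \<open>h\<close> is affine in it, the expectation over the updates moves inside
      \<open>h\<close>.\<close>
    define h where "h k v n = (ennreal (c\<^sub>f * of_bool (is_fetch \<tau> v k)) + ennreal c\<^sub>a * n) * indicator {0..T} (v k)"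
      for k v and n :: ennreal
    define f where "f = (\<lambda>(v, u). \<Sum>k. h k v (\<Sum>j. indicator {last_fetch \<tau> v (Suc k)<..v k} (u j)))"
    have f [measurable]: "f \<in> borel_measurable (paths \<Otimes>\<^sub>M paths)"
      unfolding f_def h_def is_fetch_def by measurable
    have meas [measurable]: "(\<lambda>\<omega> k. U k \<omega>) \<in> measurable M paths" "(\<lambda>\<omega> k. R k \<omega>) \<in> measurable M paths"
      using ind by (auto simp: indep_var_distribution_eq)
    define A where "A k \<omega> = clock \<tau> (\<lambda>i. jump_gap R i \<omega>) k" for k \<omega>
    define Z where "Z k \<omega> = c\<^sub>f * of_bool (A k \<omega> + jump_gap R k \<omega> > \<tau>) + K * A (Suc k) \<omega>" for k \<omega>
    have [measurable]: "A k \<in> borel_measurable M" for k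
      unfolding A_def[abs_def] by (intro borel_measurable_clock) simp
    have [measurable]: "Z k \<in> borel_measurable M" for k
      unfolding Z_def[abs_def] by measurable
    obtain e s where e: "\<And>k. 0 \<le> e k"
        "\<And>k. (\<integral>\<^sup>+\<omega>. ennreal (Z k \<omega>) * indicator {..T} (R k \<omega>) \<partial>M) = ennreal (e k)"
        and s: "e sums s" "\<bar>s - K * \<tau> * r * T\<bar> \<le> 2 * c\<^sub>f + K * \<tau>"
      using R.sums_pull_cost[OF K \<tau> T] unfolding c\<^sub>f_eq Z_def A_def by blast
    have "AE \<omega> in M. ennreal (cost T \<omega>) = f (\<lambda>k. R k \<omega>, \<lambda>k. U k \<omega>)"
      using U.AE_jump_path R.AE_jump_path
    proof eventually_elim
      case (elim \<omega>)
      show ?case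
        unfolding cost_def item_cost_pull[OF elim(2) \<tau> elim(1)] f_def h_def prod.case
        using c c\<^sub>f_nonneg
        by (subst ennreal_sum_jumps[OF elim(2)])
           (auto simp: ennreal_plus ennreal_mult ennreal_card_jumps[OF elim(1), symmetric]
              simp del: greaterThanAtMost_iff)
    qed
    hence "(\<integral>\<^sup>+\<omega>. ennreal (cost T \<omega>) \<partial>M) = (\<integral>\<^sup>+\<omega>. f (\<lambda>k. R k \<omega>, \<lambda>k. U k \<omega>) \<partial>M)"
      by (rule nn_integral_cong_AE)
    also have "\<dots> = (\<integral>\<^sup>+\<omega>. (\<integral>\<^sup>+\<omega>'. f (\<lambda>k. R k \<omega>, \<lambda>k. U k \<omega>') \<partial>M) \<partial>M)"
      by (rule nn_integral_indep_var[OF ind f])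
    also have "\<dots> = (\<integral>\<^sup>+\<omega>. (\<Sum>k. ennreal (Z k \<omega>) * indicator {..T} (R k \<omega>)) \<partial>M)"
    proof (rule nn_integral_cong_AE)
      have "AE \<omega> in M. \<forall>k. jump_gap R k \<omega> > 0"
        using R.AE_gap_pos by (simp add: AE_all_countable)
      with R.AE_jump_path
      show "AE \<omega> in M. (\<integral>\<^sup>+\<omega>'. f (\<lambda>k. R k \<omega>, \<lambda>k. U k \<omega>') \<partial>M)
          = (\<Sum>k. ennreal (Z k \<omega>) * indicator {..T} (R k \<omega>))"
      proof eventually_elim
        case (elim \<omega>)
        let ?v = "\<lambda>k. R k \<omega>"
        have "(\<integral>\<^sup>+\<omega>'. f (?v, \<lambda>k. U k \<omega>') \<partial>M)
            = (\<Sum>k. \<integral>\<^sup>+\<omega>'. h k ?v (\<Sum>j. indicator {last_fetch \<tau> ?v (Suc k)<..?v k} (U j \<omega>')) \<partial>M)"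
          unfolding f_def prod.case h_def by (intro nn_integral_suminf) measurable
        also have "\<dots> = (\<Sum>k. h k ?v (\<integral>\<^sup>+\<omega>'. (\<Sum>j. indicator {last_fetch \<tau> ?v (Suc k)<..?v k} (U j \<omega>')) \<partial>M))"
          unfolding h_def
          by (intro suminf_cong) (simp add: nn_integral_multc nn_integral_add nn_integral_cmult emeasure_space_1)
        also have "\<dots> = (\<Sum>k. ennreal (Z k \<omega>) * indicator {..T} (R k \<omega>))"
        proof (intro suminf_cong)
          fix k
          have A: "?v k - last_fetch \<tau> ?v (Suc k) = A (Suc k) \<omega>"
            unfolding A_def by (rule jump_minus_last_fetch_Suc)
          have "0 \<le> A (Suc k) \<omega> \<and> A (Suc k) \<omega> \<le> \<tau>"
            unfolding A_def using elim(2) \<tau> by (intro clock_bounds) (auto intro: less_imp_le)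
          moreover from this have "(\<integral>\<^sup>+\<omega>'. (\<Sum>j. indicator {last_fetch \<tau> ?v (Suc k)<..?v k} (U j \<omega>')) \<partial>M)
              = ennreal (l * A (Suc k) \<omega>)"
            unfolding A[symmetric]
            by (intro U.nn_integral_jumps_Ioc) (use last_fetch_nonneg[OF elim(1) \<tau>] in auto)
          moreover have "R k \<omega> > 0" by (rule jump_path_pos[OF elim(1)])
          ultimately show "h k ?v (\<integral>\<^sup>+\<omega>'. (\<Sum>j. indicator {last_fetch \<tau> ?v (Suc k)<..?v k} (U j \<omega>')) \<partial>M)
              = ennreal (Z k \<omega>) * indicator {..T} (R k \<omega>)"
            using c c\<^sub>f_nonneg U.rate_pos
            by (auto simp: h_def Z_def K_def is_fetch_iff_clock A_def ennreal_mult'[symmetric]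
                ennreal_plus[symmetric] mult.assoc simp del: ennreal_plus clock.simps split: split_indicator)
        qed
        finally show ?case .
      qed
    qed
    also have "\<dots> = (\<Sum>k. ennreal (e k))"
      by (subst nn_integral_suminf) (auto simp: e(2))
    also have "\<dots> = ennreal s"
      using s(1) suminf_ennreal2[OF e(1)] by (simp add: sums_iff)
    finally have nn: "(\<integral>\<^sup>+\<omega>. ennreal (cost T \<omega>) \<partial>M) = ennreal s" .
    have m: "cost T \<in> borel_measurable M"
      unfolding cost_def by (intro borel_measurable_item_cost_pull) auto
    have pos: "cost T \<omega> \<ge> 0" for \<omega> unfolding cost_def by (intro item_cost_nonneg c c\<^sub>f_nonneg)
    have "integrable M (cost T)"
      using m pos nn by (intro integrableI_nonneg) auto
    moreover have "expectation (cost T) = s"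
      using m pos nn s(1) suminf_nonneg[of e] e(1)
      by (subst integral_eq_nn_integral) (auto simp: sums_iff)
    ultimately show ?thesis using s(2) by (simp add: K_def)
  qed
  thus ?thesis by (intro exI[of _ "2 * c\<^sub>f + K * \<tau>"]) simp
qed

section \<open>The long-run average\<close>

lemma (in prob_space) indep_vars_imp_indep_var:
  assumes ind: "indep_vars M' X I" and "i \<in> I" "j \<in> I" "i \<noteq> j"
  shows "indep_var (M' i) (X i) (M' j) (X j)"
proof -
  have "indep_var (PiM {i} M') (\<lambda>\<omega>. restrict (\<lambda>i. X i \<omega>) {i}) (PiM {j} M') (\<lambda>\<omega>. restrict (\<lambda>i. X i \<omega>) {j})"
    using assms by (intro indep_var_restrict[OF ind]) auto
  hence "indep_var (M' i) ((\<lambda>f. f i) \<circ> (\<lambda>\<omega>. restrict (\<lambda>i. X i \<omega>) {i}))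
      (M' j) ((\<lambda>f. f j) \<circ> (\<lambda>\<omega>. restrict (\<lambda>i. X i \<omega>) {j}))"
    by (rule indep_var_compose) simp_all
  thus ?thesis by (simp add: comp_def)
qed

text \<open>At this threshold \<open>c\<^sub>f * l / m\<close> and
  \<open>c\<^sub>a * r * m / 2\<close> coincide, the equality case of the arithmetic-geometric mean
  inequality.\<close>

lemma push_rate:
  assumes "l > 0" "r > 0" "c\<^sub>f > 0" "c\<^sub>a > 0" and m: "m = sqrt (2 * l * c\<^sub>f / (r * c\<^sub>a))"
  shows "c\<^sub>f * l / m + c\<^sub>a * r * (m - 1) / 2 = sqrt (2 * l * r * c\<^sub>a * c\<^sub>f) - 1 / 2 * r * c\<^sub>a"
proof -
  have "m > 0" and m2: "m\<^sup>2 = 2 * l * c\<^sub>f / (r * c\<^sub>a)" using assms by simp_all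
  have "c\<^sub>f * l = m\<^sup>2 * r * c\<^sub>a / 2" using assms(1-4) unfolding m2 by simp
  hence "c\<^sub>f * l / m = m * r * c\<^sub>a / 2" using \<open>m > 0\<close> by (simp add: power2_eq_square)
  moreover have "sqrt (2 * l * r * c\<^sub>a * c\<^sub>f) = m * r * c\<^sub>a"
  proof (rule real_sqrt_unique)
    show "(m * r * c\<^sub>a)\<^sup>2 = 2 * l * r * c\<^sub>a * c\<^sub>f"
      using assms(1-4) unfolding power_mult_distrib m2 by (simp add: power2_eq_square)
  qed (use \<open>m > 0\<close> assms in simp)
  ultimately show ?thesis by (simp add: field_simps)
qed

text \<open>The timeout is the nonnegative root of a quadratic equation, which states exactly that
  \<open>c\<^sub>f\<close> is the balanced fetch cost.\<close>

lemma optimal_pull_timeout_properties: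
  assumes "l > 0" "r > 0" "c\<^sub>f > 0" "c\<^sub>a > 0"
  defines "\<tau> \<equiv> optimal_pull_timeout c\<^sub>f c\<^sub>a l r"
  shows "\<tau> \<ge> 0" "c\<^sub>f = c\<^sub>a * l * (\<tau> + r * \<tau>\<^sup>2 / 2)"
    "c\<^sub>a * l * \<tau> * r = l * c\<^sub>a * (sqrt (1 + 2 * r * c\<^sub>f / (l * c\<^sub>a)) - 1)"
proof -
  define s where "s = sqrt (1 + 2 * r * c\<^sub>f / (c\<^sub>a * l))"
  have \<tau>: "\<tau> = (s - 1) / r" by (simp add: \<tau>_def optimal_pull_timeout_def s_def)
  have "s\<^sup>2 = 1 + 2 * r * c\<^sub>f / (c\<^sub>a * l)" using assms(1-4) by (simp add: s_def)
  hence "c\<^sub>f = c\<^sub>a * l * ((s\<^sup>2 - 1) / (2 * r))" using assms(1-4) by simp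
  also have "(s\<^sup>2 - 1) / (2 * r) = \<tau> + r * \<tau>\<^sup>2 / 2"
    using assms(2) unfolding \<tau> by (simp add: field_simps power2_eq_square)
  finally show "c\<^sub>f = c\<^sub>a * l * (\<tau> + r * \<tau>\<^sup>2 / 2)" .
  show "\<tau> \<ge> 0" unfolding \<tau> s_def using assms(1-4) by simp
  show "c\<^sub>a * l * \<tau> * r = l * c\<^sub>a * (sqrt (1 + 2 * r * c\<^sub>f / (l * c\<^sub>a)) - 1)"
    using assms(2) by (simp add: \<tau> s_def mult.commute)
qed

lemma tendsto_average:
  fixes E :: "real \<Rightarrow> real"
  assumes B: "\<And>T. T \<ge> 0 \<Longrightarrow> \<bar>E T - c * T\<bar> \<le> B"
  shows "((\<lambda>T. E T / T) \<longlongrightarrow> c) at_top"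
proof (rule LIM_zero_cancel)
  have "((\<lambda>T. B / T) \<longlongrightarrow> 0) at_top"
    by (rule real_tendsto_divide_at_top[OF tendsto_const filterlim_ident])
  moreover have "eventually (\<lambda>T. norm (E T / T - c) \<le> B / T) at_top"
    using eventually_gt_at_top[of 0]
  proof eventually_elim
    case (elim T)
    have "\<bar>E T / T - c\<bar> = \<bar>E T - c * T\<bar> / T"
      using elim by (simp add: field_simps abs_if)
    thus ?case using B[of T] elim by (simp add: divide_right_mono)
  qed
  ultimately show "((\<lambda>T. E T / T - c) \<longlongrightarrow> 0) at_top"
    by (rule Lim_null_comparison[rotated])
qed

theorem theorem3:
  fixes M :: "'w measure"
    and N :: nat
    and \<beta> c\<^sub>f c\<^sub>a :: real
    and p lam :: "nat \<Rightarrow> real"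
    and upd req :: "nat \<Rightarrow> nat \<Rightarrow> 'w \<Rightarrow> real"
  defines "y \<equiv> \<lambda>n. \<beta> * p n / lam n"
  defines "nstar \<equiv> num_push_items N y (zero_gain_threshold c\<^sub>f c\<^sub>a)"
  defines "\<eta> \<equiv> \<lambda>n. optimal_push_threshold c\<^sub>f c\<^sub>a (lam n) (\<beta> * p n)"
  defines "\<tau> \<equiv> \<lambda>n. optimal_pull_timeout c\<^sub>f c\<^sub>a (lam n) (\<beta> * p n)"
  defines "S \<equiv> \<lambda>n \<omega>. if n \<in> {1..nstar} then push_fetches (\<eta> n) (\<lambda>k. upd n k \<omega>)
                      else pull_fetches (\<tau> n) (\<lambda>k. req n k \<omega>)"
  assumes "prob_space M"
    and "N \<ge> 1" and "\<beta> > 0" and "c\<^sub>f > c\<^sub>a" and "c\<^sub>a > 0"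
    and "\<And>n. n \<in> {1..N} \<Longrightarrow> p n > 0" and "(\<Sum>n=1..N. p n) = 1"
    and "\<And>n. n \<in> {1..N} \<Longrightarrow> lam n > 0"
    and "\<And>n. n \<in> {1..N} \<Longrightarrow> poisson_process M (lam n) (upd n)"
    and "\<And>n. n \<in> {1..N} \<Longrightarrow> poisson_process M (\<beta> * p n) (req n)"
    and "independent_processes M ({1..N} <+> {1..N}) (case_sum upd req)"
    and "\<And>m n. 1 \<le> m \<Longrightarrow> m \<le> n \<Longrightarrow> n \<le> N \<Longrightarrow> y m \<ge> y n"
    and "\<And>n. n \<in> {1..nstar} \<Longrightarrow> sqrt (2 * lam n * c\<^sub>f / (\<beta> * p n * c\<^sub>a)) \<in> \<int>"
  shows "((\<lambda>T. prob_space.expectation M (\<lambda>\<omega>. \<Sum>n=1..N.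
              item_cost c\<^sub>f c\<^sub>a (\<lambda>k. upd n k \<omega>) (\<lambda>k. req n k \<omega>) (S n \<omega>) T) / T)
          \<longlongrightarrow> (\<Sum>n=1..nstar. sqrt (2 * lam n * \<beta> * p n * c\<^sub>a * c\<^sub>f) - 1 / 2 * \<beta> * p n * c\<^sub>a)
            + (\<Sum>n=nstar+1..N. lam n * c\<^sub>a * (sqrt (1 + 2 * \<beta> * p n * c\<^sub>f / (lam n * c\<^sub>a)) - 1)))
         at_top"
proof -
  interpret prob_space M by fact
  note pos = \<open>\<beta> > 0\<close> \<open>c\<^sub>f > c\<^sub>a\<close> \<open>c\<^sub>a > 0\<close>
  have "c\<^sub>f > 0" using pos by simp
  define cost where "cost n T \<omega> = item_cost c\<^sub>f c\<^sub>a (\<lambda>k. upd n k \<omega>) (\<lambda>k. req n k \<omega>) (S n \<omega>) T" for n T \<omega>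
  define push where "push n = sqrt (2 * lam n * \<beta> * p n * c\<^sub>a * c\<^sub>f) - 1 / 2 * \<beta> * p n * c\<^sub>a" for n
  define pull where "pull n = lam n * c\<^sub>a * (sqrt (1 + 2 * \<beta> * p n * c\<^sub>f / (lam n * c\<^sub>a)) - 1)" for n
  define rate where "rate n = (if n \<in> {1..nstar} then push n else pull n)" for n
  have item: "\<exists>B. \<forall>T\<ge>0. integrable M (cost n T) \<and> \<bar>expectation (cost n T) - rate n * T\<bar> \<le> B"
    if n: "n \<in> {1..N}" for n
  proof -
    have l: "lam n > 0" and r: "\<beta> * p n > 0" using assms n pos by auto
    have U: "poisson M (upd n) (lam n)" and R: "poisson M (req n) (\<beta> * p n)"
      using l r assms(14,15)[OF n] by unfold_locales auto
    have "indep_vars (\<lambda>_. paths) (\<lambda>i \<omega> k. case_sum upd req i k \<omega>) ({1..N} <+> {1..N})"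
      using assms(16) by (simp add: independent_processes_def)
    note ind = indep_vars_imp_indep_var[OF this]
    show ?thesis
    proof (cases "n \<in> {1..nstar}")
      case True
      define m where "m = nat \<lfloor>\<eta> n\<rfloor>"
      have "\<eta> n \<in> \<int>" "\<eta> n > 0"
        using assms(18)[OF True] l r \<open>c\<^sub>f > 0\<close> pos
        by (simp_all add: \<eta>_def optimal_push_threshold_def)
      hence m: "real m = \<eta> n" "m \<ge> 1"
        by (auto simp: m_def Ints_def)
      have "indep_var paths (\<lambda>\<omega> k. upd n k \<omega>) paths (\<lambda>\<omega> k. req n k \<omega>)"
        using ind[OF InlI[OF n] InrI[OF n]] by simp
      from expectation_item_cost_push[OF U R this m(2), of c\<^sub>f c\<^sub>a]
      have "\<exists>B. \<forall>T\<ge>0. integrable M (cost n T) \<and>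
          \<bar>expectation (cost n T) - (c\<^sub>f * lam n / real m + c\<^sub>a * (\<beta> * p n) * (real m - 1) / 2) * T\<bar> \<le> B"
        using True pos \<open>c\<^sub>f > 0\<close> m(1) unfolding cost_def[abs_def] S_def by simp
      moreover have "c\<^sub>f * lam n / real m + c\<^sub>a * (\<beta> * p n) * (real m - 1) / 2 = rate n"
        using True push_rate[OF l r \<open>c\<^sub>f > 0\<close> \<open>c\<^sub>a > 0\<close>, of "real m"] m(1)
        by (simp add: rate_def push_def \<eta>_def optimal_push_threshold_def mult.assoc)
      ultimately show ?thesis by simp
    next
      case False
      note \<tau>' = optimal_pull_timeout_properties[OF l r \<open>c\<^sub>f > 0\<close> \<open>c\<^sub>a > 0\<close>]
      have "indep_var paths (\<lambda>\<omega> k. req n k \<omega>) paths (\<lambda>\<omega> k. upd n k \<omega>)"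
        using ind[OF InrI[OF n] InlI[OF n]] by simp
      from expectation_item_cost_pull[OF U R this \<tau>'(1) _ \<tau>'(2)]
      have "\<exists>B. \<forall>T\<ge>0. integrable M (cost n T) \<and>
          \<bar>expectation (cost n T) - c\<^sub>a * lam n * \<tau> n * (\<beta> * p n) * T\<bar> \<le> B"
        using False pos unfolding cost_def[abs_def] S_def \<tau>_def if_not_P[OF False] by simp
      moreover have "c\<^sub>a * lam n * \<tau> n * (\<beta> * p n) = rate n"
        using \<tau>'(3) unfolding rate_def if_not_P[OF False] pull_def \<tau>_def by (simp only: mult.assoc)
      ultimately show ?thesis by simp
    qed
  qed
  hence int: "integrable M (cost n T)" if "n \<in> {1..N}" "T \<ge> 0" for n T
    using that by blast
  have "((\<lambda>T. expectation (cost n T) / T) \<longlongrightarrow> rate n) at_top" if "n \<in> {1..N}" for n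
    using item[OF that] tendsto_average[of "\<lambda>T. expectation (cost n T)" "rate n"] by blast
  hence "((\<lambda>T. \<Sum>n=1..N. expectation (cost n T) / T) \<longlongrightarrow> (\<Sum>n=1..N. rate n)) at_top"
    by (rule tendsto_sum)
  moreover have "eventually (\<lambda>T. (\<Sum>n=1..N. expectation (cost n T) / T)
      = expectation (\<lambda>\<omega>. \<Sum>n=1..N. cost n T \<omega>) / T) at_top"
    using eventually_ge_at_top[of 0]
  proof eventually_elim
    case (elim T)
    have "expectation (\<lambda>\<omega>. \<Sum>n=1..N. cost n T \<omega>) = (\<Sum>n=1..N. expectation (cost n T))"
      using int elim by (intro Bochner_Integration.integral_sum) auto
    thus ?case by (simp add: sum_divide_distrib)
  qed
  ultimately have "((\<lambda>T. expectation (\<lambda>\<omega>. \<Sum>n=1..N. cost n T \<omega>) / T) \<longlongrightarrow> (\<Sum>n=1..N. rate n)) at_top"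
    by (rule Lim_transform_eventually)
  moreover have "(\<Sum>n=1..N. rate n) = (\<Sum>n=1..nstar. push n) + (\<Sum>n=nstar+1..N. pull n)"
  proof -
    have "nstar \<in> insert 0 {n \<in> {1..N}. y n > zero_gain_threshold c\<^sub>f c\<^sub>a}"
      unfolding nstar_def num_push_items_def by (rule Max_in) auto
    hence "nstar \<le> N" by auto
    hence "{1..N} = {1..nstar} \<union> {nstar+1..N}" by auto
    hence "(\<Sum>n=1..N. rate n) = (\<Sum>n=1..nstar. rate n) + (\<Sum>n=nstar+1..N. rate n)"
      by (simp add: sum.union_disjoint)
    thus ?thesis by (simp add: rate_def)
  qed
  ultimately show ?thesis by (simp only: cost_def push_def pull_def)
qed

end
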